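(* Let $n\geq2$ and $1\leq k\leq n$ be integers. The Hadamard critical exponents for positivity, monotonicity, convexity, and super-additivity for $\mathbb{P}_n^k$ are $n-2$, $n-1$, $n$, $n$ respectively if $2\leq k\leq n$, and $0,0,1,n$ respectively if $k=1$. In particular, they are independent of the type of entrywise power used ($f_\alpha$ on $\mathbb{P}_n^k([0,\infty))$, or $\phi_\alpha$ on $\mathbb{P}_n^k(\mathbb{R})$, or $\psi_\alpha$ on $\mathbb{P}_n^k(\mathbb{R})$).
   Context: For $I\subset\mathbb{R}$, $\mathbb{P}_n(I)$ is the set of real symmetric positive semidefinite $n\times n$ matrices with all entries in $I$; $\mathbb{P}_n:=\mathbb{P}_n(\mathbb{R})$; $\mathbb{P}_n^k(I)$ is the set of matrices in $\mathbb{P}_n(I)$ of rank at most $k$. For symmetric $A,B$, write $A\geq B$ if $A-B\in\mathbb{P}_n$. For a function $f$ and a matrix $A=(a_{ij})$, $f[A]:=(f(a_{ij}))$. For $\alpha\in\mathbb{R}$: $f_\alpha(x):=x^\alpha$ for $x>0$; $\phi_\alpha(x):=|x|^\alpha$ and $\psi_\alpha(x):=\operatorname{sign}(x)|x|^\alpha$ for real $x\neq 0$; and $f_\alpha(0)=\phi_\alpha(0)=\psi_\alpha(0):=0$ for every $\alpha$. For $V\subset\mathbb{P}_n(I)$, a function $f:I\to\mathbb{R}$ is: positive on $V$ if $f[A]\geq 0$ for all $A\in V$; monotone on $V$ if $f[A]\geq f[B]$ for all $A,B\in V$ with $A\geq B\geq 0$; convex on $V$ if $f[\lambda A+(1-\lambda)B]\leq\lambda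 f[A]+(1-\lambda)f[B]$ for all $0\leq\lambda\leq1$ and all $A,B\in V$ with $A\geq B\geq0$; super-additive on $V$ if $f[A+B]\geq f[A]+f[B]$ for all $A,B\in V$ for which $f[A+B]$ is defined. For each of these properties and each of the three families ($f_\alpha$ on $V=\mathbb{P}_n^k([0,\infty))$; $\phi_\alpha$ or $\psi_\alpha$ on $V=\mathbb{P}_n^k(\mathbb{R})$), the Hadamard critical exponent is the smallest real $\alpha_0\geq0$ such that for every real $\alpha\geq\alpha_0$ the function in the family with exponent $\alpha$ has the property on $V$. *)

theory Defs
  imports "HOL-Analysis.Analysis"
begin

text \<open>Square matrices of size \<open>n\<close> have type \<open>real ^ 'n ^ 'n\<close> with \<open>n = CARD('n)\<close>.
  The entrywise application \<open>f[A]\<close> is \<^const>\<open>map_matrix\<close> \<open>f A\<close>.\<close>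

definition psd :: "real ^ 'n ^ 'n \<Rightarrow> bool" where
  "psd A \<longleftrightarrow> transpose A = A \<and> (\<forall>x. 0 \<le> x \<bullet> (A *v x))"

definition loewner_le :: "real ^ 'n ^ 'n \<Rightarrow> real ^ 'n ^ 'n \<Rightarrow> bool"  (infix "\<preceq>\<^sub>L" 50) where
  "B \<preceq>\<^sub>L A \<longleftrightarrow> psd (A - B)"

definition entries_in :: "real set \<Rightarrow> real ^ 'n ^ 'n \<Rightarrow> bool" where
  "entries_in I A \<longleftrightarrow> (\<forall>i j. A $ i $ j \<in> I)"

definition psd_rank_le :: "nat \<Rightarrow> real set \<Rightarrow> (real ^ 'n ^ 'n) set" where
  "psd_rank_le k I = {A. psd A \<and> entries_in I A \<and> rank A \<le> k}"

text \<open>In the library \<open>0 powr a = 0\<close> for every \<open>a\<close>, including \<open>a \<le> 0\<close>, so all three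
  functions below vanish at \<open>0\<close> for every exponent. \<open>f_pow\<close> is meant on \<open>[0, \<infinity>)\<close> only.\<close>

definition f_pow :: "real \<Rightarrow> real \<Rightarrow> real" where
  "f_pow \<alpha> x = x powr \<alpha>"

definition phi_pow :: "real \<Rightarrow> real \<Rightarrow> real" where
  "phi_pow \<alpha> x = \<bar>x\<bar> powr \<alpha>"

definition psi_pow :: "real \<Rightarrow> real \<Rightarrow> real" where
  "psi_pow \<alpha> x = sgn x * \<bar>x\<bar> powr \<alpha>"

definition hadamard_positive :: "(real ^ 'n ^ 'n) set \<Rightarrow> (real \<Rightarrow> real) \<Rightarrow> bool" where
  "hadamard_positive V f \<longleftrightarrow> (\<forall>A\<in>V. 0 \<preceq>\<^sub>L map_matrix f A)"

definition hadamard_monotone :: "(real ^ 'n ^ 'n) set \<Rightarrow> (real \<Rightarrow> real) \<Rightarrow> bool" where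
  "hadamard_monotone V f \<longleftrightarrow>
     (\<forall>A\<in>V. \<forall>B\<in>V. B \<preceq>\<^sub>L A \<and> 0 \<preceq>\<^sub>L B \<longrightarrow> map_matrix f B \<preceq>\<^sub>L map_matrix f A)"

definition hadamard_convex :: "(real ^ 'n ^ 'n) set \<Rightarrow> (real \<Rightarrow> real) \<Rightarrow> bool" where
  "hadamard_convex V f \<longleftrightarrow>
     (\<forall>t. \<forall>A\<in>V. \<forall>B\<in>V. 0 \<le> t \<and> t \<le> 1 \<and> B \<preceq>\<^sub>L A \<and> 0 \<preceq>\<^sub>L B \<longrightarrow>
        map_matrix f (t *\<^sub>R A + (1 - t) *\<^sub>R B)
          \<preceq>\<^sub>L t *\<^sub>R map_matrix f A + (1 - t) *\<^sub>R map_matrix f B)"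

text \<open>Functions being total, the domain \<open>I\<close> of \<open>f\<close> is passed explicitly:
  \<open>f[A + B]\<close> is defined when the entries of \<open>A + B\<close> lie in \<open>I\<close>.\<close>

definition hadamard_superadditive ::
    "real set \<Rightarrow> (real ^ 'n ^ 'n) set \<Rightarrow> (real \<Rightarrow> real) \<Rightarrow> bool" where
  "hadamard_superadditive I V f \<longleftrightarrow>
     (\<forall>A\<in>V. \<forall>B\<in>V. entries_in I (A + B) \<longrightarrow>
        map_matrix f A + map_matrix f B \<preceq>\<^sub>L map_matrix f (A + B))"

text \<open>\<open>critical_exponent P a\<close>: the smallest nonnegative real such that \<open>P\<close> holds from there on
  exists and equals \<open>a\<close>. It is a relation and not a \<open>LEAST\<close> term so that existence is asserted.\<close>

definition critical_exponent :: "(real \<Rightarrow> bool) \<Rightarrow> real \<Rightarrow> bool" where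
  "critical_exponent P a \<longleftrightarrow>
     0 \<le> a \<and> (\<forall>\<alpha>\<ge>a. P \<alpha>) \<and> (\<forall>b. 0 \<le> b \<and> (\<forall>\<alpha>\<ge>b. P \<alpha>) \<longrightarrow> a \<le> b)"

end

theory Submission
  imports Defs
begin

text \<open>Upper bounds: along a segment of matrices with direction \<open>D \<ge> 0\<close>, the derivative of an
  entrywise power of exponent \<open>\<alpha>\<close> is \<open>\<alpha>\<close> times the Hadamard product of \<open>D\<close> with a power of
  exponent \<open>\<alpha> - 1\<close>. By Schur's product theorem, positivity for \<open>\<alpha> - 1\<close> gives monotonicity for \<open>\<alpha>\<close>,
  and monotonicity for \<open>\<alpha> - 1\<close> gives convexity and super-additivity for \<open>\<alpha>\<close>. Positivity for
  \<open>\<alpha> \<ge> n - 2\<close> follows by induction on \<open>n\<close>, splitting off a rank one matrix.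

  Lower bounds: expand \<open>(1 + \<epsilon> x\<^sub>i x\<^sub>j)\<^sup>\<alpha>\<close> in powers of \<open>\<epsilon>\<close> and test against a vector orthogonal to
  \<open>n - 1\<close> consecutive powers of \<open>x\<close>. The leading coefficient has the sign of a generalised binomial
  coefficient, which is negative for \<open>\<alpha>\<close> in the unit interval below the critical exponent. For
  super-additivity, the term \<open>\<epsilon>\<^sup>\<alpha>\<close> with \<open>\<alpha> < n\<close> dominates instead.

  In rank one, \<open>A \<ge> B \<ge> 0\<close> forces \<open>B\<close> to be a multiple of \<open>A\<close>, and everything is scalar.\<close>

section \<open>Positive semidefinite kernels on finite sets\<close>

text \<open>Rows and columns are indexed by a finite set instead of a type, so that inductions on
  the size can remove one index at a time.\<close>

definition kpsd :: "'a set \<Rightarrow> ('a \<Rightarrow> 'a \<Rightarrow> real) \<Rightarrow> bool" where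
  "kpsd S K \<longleftrightarrow> (\<forall>i\<in>S. \<forall>j\<in>S. K i j = K j i) \<and>
     (\<forall>c. 0 \<le> (\<Sum>i\<in>S. \<Sum>j\<in>S. c i * c j * K i j))"

lemma kpsd_sym: "kpsd S K \<Longrightarrow> i \<in> S \<Longrightarrow> j \<in> S \<Longrightarrow> K i j = K j i"
  by (auto simp: kpsd_def)

lemma kpsd_nonneg: "kpsd S K \<Longrightarrow> 0 \<le> (\<Sum>i\<in>S. \<Sum>j\<in>S. c i * c j * K i j)"
  by (auto simp: kpsd_def)

lemma kpsdI:
  assumes "\<And>i j. i \<in> S \<Longrightarrow> j \<in> S \<Longrightarrow> K i j = K j i"
    and "\<And>c. 0 \<le> (\<Sum>i\<in>S. \<Sum>j\<in>S. c i * c j * K i j)"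
  shows "kpsd S K"
  using assms by (simp add: kpsd_def)

lemma kpsd_add:
  assumes "kpsd S K" "kpsd S L"
  shows "kpsd S (\<lambda>i j. K i j + L i j)"
  using assms by (auto simp: kpsd_def distrib_left sum.distrib intro!: add_nonneg_nonneg)

lemma kpsd_scale:
  assumes "kpsd S K" "0 \<le> (r::real)"
  shows "kpsd S (\<lambda>i j. r * K i j)"
proof (rule kpsdI)
  fix c :: "'a \<Rightarrow> real"
  have "(\<Sum>i\<in>S. \<Sum>j\<in>S. c i * c j * (r * K i j)) = r * (\<Sum>i\<in>S. \<Sum>j\<in>S. c i * c j * K i j)"
    by (simp add: sum_distrib_left mult_ac)
  then show "0 \<le> (\<Sum>i\<in>S. \<Sum>j\<in>S. c i * c j * (r * K i j))"
    using assms by (simp add: kpsd_nonneg)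
qed (use assms in \<open>auto simp: kpsd_def\<close>)

lemma kpsd_rank_one: "kpsd S (\<lambda>i j. z i * z j)"
proof (rule kpsdI)
  fix c :: "'a \<Rightarrow> real"
  have "(\<Sum>i\<in>S. \<Sum>j\<in>S. c i * c j * (z i * z j)) = (\<Sum>i\<in>S. c i * z i)\<^sup>2"
    by (simp add: power2_eq_square sum_product mult_ac)
  then show "0 \<le> (\<Sum>i\<in>S. \<Sum>j\<in>S. c i * c j * (z i * z j))"
    by simp
qed simp

text \<open>Puts the removed index back after a Schur complement, whose row and column at
  \<open>a\<close> vanish.\<close>

lemma kpsd_insert_zero:
  assumes "finite S" "a \<notin> S" "kpsd S K"
    and "\<And>i. i \<in> insert a S \<Longrightarrow> K a i = 0" "\<And>i. i \<in> insert a S \<Longrightarrow> K i a = 0"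
  shows "kpsd (insert a S) K"
proof (rule kpsdI)
  fix c :: "'a \<Rightarrow> real"
  have "(\<Sum>i\<in>insert a S. \<Sum>j\<in>insert a S. c i * c j * K i j) = (\<Sum>i\<in>S. \<Sum>j\<in>S. c i * c j * K i j)"
    using assms by simp
  then show "0 \<le> (\<Sum>i\<in>insert a S. \<Sum>j\<in>insert a S. c i * c j * K i j)"
    using assms(3) by (simp only: kpsd_nonneg)
qed (use assms in \<open>auto simp: kpsd_def\<close>)

lemma kpsd_diag:
  assumes "finite S" "kpsd S K" "a \<in> S"
  shows "0 \<le> K a a"
proof -
  have "(\<Sum>i\<in>S. \<Sum>j\<in>S. (if i = a then 1 else 0) * (if j = a then 1 else 0) * K i j)
      = (\<Sum>i\<in>S. if i = a then (\<Sum>j\<in>S. if j = a then K a j else 0) else 0)"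
    by (intro sum.cong refl) (auto intro!: sum.cong)
  also have "\<dots> = K a a"
    using assms by simp
  finally show ?thesis
    using kpsd_nonneg[OF assms(2), of "\<lambda>i. if i = a then 1 else 0"] by simp
qed

section \<open>Schur complements and Schur's product theorem\<close>

lemma sum_sum_insert:
  fixes F :: "'a \<Rightarrow> 'a \<Rightarrow> real"
  assumes "finite S" "a \<notin> S"
  shows "(\<Sum>i\<in>insert a S. \<Sum>j\<in>insert a S. F i j)
    = F a a + (\<Sum>i\<in>S. F a i + F i a) + (\<Sum>i\<in>S. \<Sum>j\<in>S. F i j)"
  using assms by (simp add: sum.distrib)

lemma linear_quadratic_nonneg_imp_zero:
  fixes p q :: real
  assumes "\<And>s. 0 \<le> 2 * s * p + q"
  shows "p = 0"
proof (rule ccontr)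
  assume "p \<noteq> 0"
  \<comment> \<open>The chosen \<open>s\<close> makes the expression equal to -1.\<close>
  then show False
    using assms[of "- (q + 1) / (2 * p)"] by (simp add: field_simps)
qed

text \<open>In terms of \<open>z\<close>, one step of the Cholesky decomposition: if \<open>K a a > 0\<close> then
  \<open>z i = K a i / sqrt (K a a)\<close>, and if \<open>K a a = 0\<close> then row \<open>a\<close> vanishes and \<open>z = 0\<close>.\<close>

lemma kpsd_schur_complement:
  assumes S: "finite S" "a \<notin> S" and K: "kpsd (insert a S) K"
  obtains z where "\<And>i. i \<in> insert a S \<Longrightarrow> K a i = z a * z i"
    and "kpsd S (\<lambda>i j. K i j - z i * z j)"
proof -
  have sym: "K i j = K j i" if "i \<in> insert a S" "j \<in> insert a S" for i j
    using K that by (rule kpsd_sym)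
  \<comment> \<open>The quadratic form of \<open>K\<close> at the vector with value \<open>s\<close>
    at \<open>a\<close> and \<open>c\<close> on \<open>S\<close>, seen as a polynomial in
    \<open>s\<close>.\<close>
  have form: "0 \<le> s\<^sup>2 * K a a + 2 * s * (\<Sum>i\<in>S. c i * K a i) + (\<Sum>i\<in>S. \<Sum>j\<in>S. c i * c j * K i j)"
    for s c
  proof -
    let ?c = "\<lambda>i. if i = a then s else c i"
    have ne: "i \<noteq> a" if "i \<in> S" for i using that S by auto
    have "(\<Sum>i\<in>insert a S. \<Sum>j\<in>insert a S. ?c i * ?c j * K i j)
        = s\<^sup>2 * K a a + (\<Sum>i\<in>S. s * c i * K a i + c i * s * K i a)
          + (\<Sum>i\<in>S. \<Sum>j\<in>S. c i * c j * K i j)"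
      unfolding sum_sum_insert[OF S]
      by (simp add: ne power2_eq_square cong: sum.cong)
    also have "(\<Sum>i\<in>S. s * c i * K a i + c i * s * K i a) = 2 * s * (\<Sum>i\<in>S. c i * K a i)"
      by (simp add: sum_distrib_left sym mult_ac cong: sum.cong)
    finally show ?thesis
      using kpsd_nonneg[OF K, of ?c] by simp
  qed
  have Kaa: "0 \<le> K a a"
    using kpsd_diag[OF _ K] S by simp
  show thesis
  proof (cases "K a a = 0")
    case True
    have "K a i = 0" if "i \<in> S" for i
    proof -
      have "(\<Sum>j\<in>S. (if j = i then 1 else 0) * K a j) = (\<Sum>j\<in>S. if j = i then K a j else 0)"
        by (intro sum.cong) auto
      then have "(\<Sum>j\<in>S. (if j = i then 1 else 0) * K a j) = K a i"
        using that S by simp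
      \<comment> \<open>As \<open>K a a = 0\<close>, the polynomial is affine in \<open>s\<close>;
        for the unit vector at \<open>i\<close> its slope must vanish.\<close>
      then have "0 \<le> 2 * s * K a i + (\<Sum>j\<in>S. \<Sum>l\<in>S. (if j = i then 1 else 0) * (if l = i then 1 else 0) * K j l)" for s
        using form[of s "\<lambda>j. if j = i then 1 else 0"] True by simp
      then show ?thesis
        by (rule linear_quadratic_nonneg_imp_zero)
    qed
    moreover have "kpsd S K"
    proof (rule kpsdI)
      show "0 \<le> (\<Sum>i\<in>S. \<Sum>j\<in>S. c i * c j * K i j)" for c
        using form[of 0 c] by simp
    qed (use sym in auto)
    ultimately show ?thesis
      using that[of "\<lambda>_. 0"] True by auto
  next
    case False
    then have pos: "0 < K a a"
      using Kaa by simp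
    define z where "z i = K a i / sqrt (K a a)" for i
    have zz: "z i * z j = K a i * K a j / K a a" for i j
      using pos by (simp add: z_def)
    have "kpsd S (\<lambda>i j. K i j - z i * z j)"
    proof (rule kpsdI)
      fix c :: "'a \<Rightarrow> real"
      let ?p = "\<Sum>i\<in>S. c i * K a i"
      have "(\<Sum>i\<in>S. \<Sum>j\<in>S. c i * c j * (K i j - z i * z j))
          = (\<Sum>i\<in>S. \<Sum>j\<in>S. c i * c j * K i j) - ?p\<^sup>2 / K a a"
        by (simp add: zz right_diff_distrib sum_subtractf power2_eq_square sum_product
            sum_divide_distrib mult_ac)
      \<comment> \<open>\<open>s = - ?p / K a a\<close> minimises the polynomial in
        \<open>s\<close>, and the minimum is the form of the complement.\<close>
      also have "\<dots> = (- ?p / K a a)\<^sup>2 * K a a + 2 * (- ?p / K a a) * ?p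
          + (\<Sum>i\<in>S. \<Sum>j\<in>S. c i * c j * K i j)"
        using pos by (simp add: field_simps power2_eq_square)
      finally show "0 \<le> (\<Sum>i\<in>S. \<Sum>j\<in>S. c i * c j * (K i j - z i * z j))"
        using form[of "- ?p / K a a" c] by simp
    qed (use sym in auto)
    then show ?thesis
      using that[of z] zz pos by simp
  qed
qed

text \<open>Split \<open>K\<close> into \<open>z z\<^sup>T\<close> and a remainder that vanishes in
  row \<open>a\<close>. Multiplying \<open>L\<close> by \<open>z z\<^sup>T\<close> only rescales the
  test vector, and the remainder is an instance on the smaller index set.\<close>

lemma kpsd_schur_product:
  assumes "finite S" "kpsd S K" "kpsd S L"
  shows "kpsd S (\<lambda>i j. K i j * L i j)"
  using assms
proof (induction S arbitrary: K L rule: finite_induct)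
  case empty
  show ?case by (simp add: kpsd_def)
next
  case (insert a S)
  obtain z where z: "\<And>i. i \<in> insert a S \<Longrightarrow> K a i = z a * z i"
    and R: "kpsd S (\<lambda>i j. K i j - z i * z j)"
    using kpsd_schur_complement[OF insert.hyps(1,2) insert.prems(1)] by blast
  have sym: "K i j = K j i" if "i \<in> insert a S" "j \<in> insert a S" for i j
    using insert.prems(1) that by (rule kpsd_sym)
  \<comment> \<open>The restriction of \<open>L\<close> to \<open>S\<close> is its Schur complement
    plus a rank one kernel.\<close>
  obtain y where "kpsd S (\<lambda>i j. L i j - y i * y j)"
    using kpsd_schur_complement[OF insert.hyps(1,2) insert.prems(2)] by blast
  then have "kpsd S L"
    using kpsd_add[OF _ kpsd_rank_one[of S y]] by force
  then have "kpsd S (\<lambda>i j. (K i j - z i * z j) * L i j)"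
    using insert.IH R by simp
  then have 1: "kpsd (insert a S) (\<lambda>i j. (K i j - z i * z j) * L i j)"
    using insert.hyps z sym by (intro kpsd_insert_zero) (auto simp: mult.commute)
  have 2: "kpsd (insert a S) (\<lambda>i j. z i * z j * L i j)"
  proof (rule kpsdI)
    show "0 \<le> (\<Sum>i\<in>insert a S. \<Sum>j\<in>insert a S. c i * c j * (z i * z j * L i j))" for c
      using kpsd_nonneg[OF insert.prems(2), of "\<lambda>i. c i * z i"] by (simp add: mult_ac)
    show "z i * z j * L i j = z j * z i * L j i" if "i \<in> insert a S" "j \<in> insert a S" for i j
      using kpsd_sym[OF insert.prems(2) that] by simp
  qed
  show ?case
    using kpsd_add[OF 1 2] by (simp add: algebra_simps)
qed

text \<open>For fixed \<open>c\<close> the form is linear in the kernel, so it is the integral of a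
  nonnegative function.\<close>

lemma kpsd_has_integral:
  assumes S: "finite S" and F: "\<And>t. t \<in> {0..1} \<Longrightarrow> kpsd S (F t)"
    and K: "\<And>i j. i \<in> S \<Longrightarrow> j \<in> S \<Longrightarrow> ((\<lambda>t. F t i j) has_integral K i j) {0..1::real}"
  shows "kpsd S K"
proof (rule kpsdI)
  fix i j assume ij: "i \<in> S" "j \<in> S"
  have "((\<lambda>t. F t i j) has_integral K j i) {0..1}"
    using K[OF ij(2,1)] by (rule has_integral_eq[rotated]) (rule kpsd_sym[OF F]; simp add: ij)
  then show "K i j = K j i"
    using K[OF ij] by (metis has_integral_unique)
next
  fix c :: "'a \<Rightarrow> real"
  have "((\<lambda>t. \<Sum>i\<in>S. \<Sum>j\<in>S. c i * c j * F t i j) has_integral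
      (\<Sum>i\<in>S. \<Sum>j\<in>S. c i * c j * K i j)) {0..1}"
    by (intro has_integral_sum S has_integral_mult_right K)
  then show "0 \<le> (\<Sum>i\<in>S. \<Sum>j\<in>S. c i * c j * K i j)"
    by (rule has_integral_nonneg) (use F kpsd_nonneg in blast)
qed

section \<open>Upper bounds\<close>

text \<open>Differentiation exchanges even and odd powers, so the two families are treated together;
  on nonnegative numbers both agree with \<open>f_pow\<close>.\<close>

definition pow_pair :: "(real \<Rightarrow> real \<Rightarrow> real) \<Rightarrow> (real \<Rightarrow> real \<Rightarrow> real) \<Rightarrow> bool" where
  "pow_pair g g' \<longleftrightarrow> g = phi_pow \<and> g' = psi_pow \<or> g = psi_pow \<and> g' = phi_pow"

lemma pow_pair_sym: "pow_pair g g' \<Longrightarrow> pow_pair g' g"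
  by (auto simp: pow_pair_def)

lemma pow_pair_mult: "pow_pair g g' \<Longrightarrow> g \<alpha> (x * y) = g \<alpha> x * g \<alpha> y"
  by (auto simp: pow_pair_def phi_pow_def psi_pow_def abs_mult powr_mult sgn_mult)

lemma pow_pair_nonneg: "pow_pair g g' \<Longrightarrow> 0 \<le> x \<Longrightarrow> g \<alpha> x = x powr \<alpha>"
  by (auto simp: pow_pair_def phi_pow_def psi_pow_def sgn_if)

text \<open>Near \<open>x\<close> the sign is constant, so both powers reduce, up to a constant
  factor, to \<open>(sgn x * y) powr \<alpha>\<close> with a positive base.\<close>

lemma pow_pair_has_derivative:
  assumes "pow_pair g g'" "x \<noteq> 0"
  shows "(g \<alpha> has_real_derivative \<alpha> * g' (\<alpha> - 1) x) (at x)"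
proof -
  have "\<forall>\<^sub>F y in nhds x. y \<in> (if x > 0 then {0<..} else {..<0})"
    using assms(2) by (intro eventually_nhds_in_open) auto
  then have ev: "\<forall>\<^sub>F y in nhds x. sgn y = sgn x"
    by eventually_elim (use assms(2) in \<open>auto simp: sgn_if split: if_splits\<close>)
  have pos: "sgn x * x > 0"
    using assms(2) by (simp add: sgn_if)
  have abs: "((\<lambda>y. (sgn x * y) powr \<alpha>) has_real_derivative \<alpha> * psi_pow (\<alpha> - 1) x) (at x)"
  proof -
    have "((\<lambda>y. (sgn x * y) powr \<alpha>) has_real_derivative \<alpha> * (sgn x * x) powr (\<alpha> - 1) * sgn x) (at x)"
      by (rule DERIV_chain2[OF has_real_derivative_powr[OF pos] DERIV_cmult_Id])
    moreover have "\<alpha> * (sgn x * x) powr (\<alpha> - 1) * sgn x = \<alpha> * psi_pow (\<alpha> - 1) x"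
      using assms(2) by (simp add: psi_pow_def sgn_if)
    ultimately show ?thesis by simp
  qed
  have phi: "(phi_pow \<alpha> has_real_derivative \<alpha> * psi_pow (\<alpha> - 1) x) (at x)"
  proof (rule DERIV_cong_ev[THEN iffD1, OF refl _ refl abs])
    show "\<forall>\<^sub>F y in nhds x. (sgn x * y) powr \<alpha> = phi_pow \<alpha> y"
      using ev by eventually_elim (use assms(2) in \<open>auto simp: phi_pow_def sgn_if split: if_splits\<close>)
  qed
  have psi: "(psi_pow \<alpha> has_real_derivative \<alpha> * phi_pow (\<alpha> - 1) x) (at x)"
  proof (rule DERIV_cong_ev[THEN iffD1, OF refl _ _ DERIV_cmult[OF abs, of "sgn x"]])
    show "\<forall>\<^sub>F y in nhds x. sgn x * (sgn x * y) powr \<alpha> = psi_pow \<alpha> y"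
      using ev by eventually_elim (use assms(2) in \<open>auto simp: psi_pow_def sgn_if split: if_splits\<close>)
    show "sgn x * (\<alpha> * psi_pow (\<alpha> - 1) x) = \<alpha> * phi_pow (\<alpha> - 1) x"
      using assms(2) by (simp add: psi_pow_def phi_pow_def sgn_if)
  qed
  show ?thesis
    using assms(1) phi psi by (auto simp: pow_pair_def)
qed

lemma continuous_on_pow_pair:
  assumes "pow_pair g g'" "1 \<le> \<alpha>"
  shows "continuous_on UNIV (g \<alpha>)"
proof -
  have phi: "continuous_on UNIV (phi_pow \<alpha>)"
    unfolding phi_pow_def[abs_def] using assms(2)
    by (intro continuous_on_powr' continuous_intros) auto
  have "isCont (psi_pow \<alpha>) x" for x
  proof (cases "x = 0")
    case True
    have "(phi_pow \<alpha> \<longlongrightarrow> 0) (at 0)"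
      using phi by (auto simp: continuous_on_eq_continuous_at isCont_def phi_pow_def[of _ 0] dest!: spec[of _ 0])
    \<comment> \<open>\<open>psi_pow\<close> and \<open>phi_pow\<close> have the same absolute
      value.\<close>
    then have "(psi_pow \<alpha> \<longlongrightarrow> 0) (at 0)"
      by (rule tendsto_rabs_zero_cancel[OF tendsto_rabs_zero_cancel, OF tendsto_cong[THEN iffD1], rotated 1])
        (auto simp: psi_pow_def phi_pow_def abs_mult sgn_if eventually_at_filter)
    then show ?thesis
      using True by (simp add: isCont_def psi_pow_def[of _ 0])
  next
    case False
    then show ?thesis
      using pow_pair_has_derivative[of psi_pow phi_pow x \<alpha>] by (auto simp: pow_pair_def intro: DERIV_isCont)
  qed
  then show ?thesis
    using assms(1) phi by (auto simp: pow_pair_def continuous_on_eq_continuous_at)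
qed

text \<open>For \<open>d \<noteq> 0\<close> the path \<open>b + t * d\<close> can meet 0 only at
  \<open>t = - b / d\<close>. The fundamental theorem tolerates this one point because
  \<open>g \<alpha>\<close> is continuous, even for \<alpha> = 1, where the integrand may
  jump.\<close>

lemma pow_pair_has_integral:
  assumes g: "pow_pair g g'" and \<alpha>: "1 \<le> \<alpha>"
  shows "((\<lambda>t. \<alpha> * (d * g' (\<alpha> - 1) (b + t * d))) has_integral g \<alpha> (b + d) - g \<alpha> b) {0..1}"
proof (cases "d = 0")
  case True
  then show ?thesis by simp
next
  case False
  have "((\<lambda>t. \<alpha> * (d * g' (\<alpha> - 1) (b + t * d))) has_integral
      (\<lambda>t. g \<alpha> (b + t * d)) 1 - (\<lambda>t. g \<alpha> (b + t * d)) 0) {0..1}"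
  proof (rule fundamental_theorem_of_calculus_interior_strong[of "{- b / d}"])
    show "continuous_on {0..1} (\<lambda>t. g \<alpha> (b + t * d))"
      by (intro continuous_on_compose2[OF continuous_on_pow_pair[OF g \<alpha>]] continuous_intros) auto
    fix t assume "t \<in> {0<..<1} - {- b / d}"
    then have "b + t * d \<noteq> 0"
      using False by (auto simp: field_simps)
    then have "((\<lambda>t. g \<alpha> (b + t * d)) has_real_derivative \<alpha> * g' (\<alpha> - 1) (b + t * d) * d) (at t)"
      by (intro DERIV_chain2[OF pow_pair_has_derivative[OF g]]) (auto intro!: derivative_eq_intros)
    then show "((\<lambda>t. g \<alpha> (b + t * d)) has_vector_derivative \<alpha> * (d * g' (\<alpha> - 1) (b + t * d))) (at t)"
      by (simp add: has_real_derivative_iff_has_vector_derivative mult_ac)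
  qed auto
  then show ?thesis by simp
qed

section \<open>Positivity, monotonicity, super-additivity and convexity for kernels\<close>

text \<open>The difference is the integral over \<open>t\<close> of \<alpha> times the Schur product
  of \<open>K - L\<close> with \<open>g' (\<alpha> - 1)\<close> along the segment from
  \<open>L\<close> to \<open>K\<close>, and both factors are positive semidefinite.\<close>

lemma kpsd_pow_diff:
  assumes S: "finite S" and g: "pow_pair g g'" and \<alpha>: "1 \<le> \<alpha>"
    and D: "kpsd S (\<lambda>i j. K i j - L i j)"
    and pos: "\<And>t. t \<in> {0..1} \<Longrightarrow> kpsd S (\<lambda>i j. g' (\<alpha> - 1) (L i j + t * (K i j - L i j)))"
  shows "kpsd S (\<lambda>i j. g \<alpha> (K i j) - g \<alpha> (L i j))"
proof (rule kpsd_has_integral[OF S])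
  show "kpsd S (\<lambda>i j. \<alpha> * ((K i j - L i j) * g' (\<alpha> - 1) (L i j + t * (K i j - L i j))))"
    if "t \<in> {0..1}" for t
    using \<alpha> by (intro kpsd_scale kpsd_schur_product S D pos that) auto
  show "((\<lambda>t. \<alpha> * ((K i j - L i j) * g' (\<alpha> - 1) (L i j + t * (K i j - L i j)))) has_integral
      g \<alpha> (K i j) - g \<alpha> (L i j)) {0..1}" for i j
    using pow_pair_has_integral[OF g \<alpha>, of "K i j - L i j" "L i j"] by simp
qed

text \<open>The induction of FitzGerald and Horn. The Schur complement vanishes in row \<open>a\<close>, so the
  derivative along the segment from \<open>z z\<^sup>T\<close> to \<open>K\<close> only involves the smaller
  index set, and differentiation exchanges the two families.\<close>

lemma kpsd_pow:
  assumes "finite S" "pow_pair g g'" "0 \<le> \<alpha>" "real (card S) - 2 \<le> \<alpha>" "kpsd S K"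
  shows "kpsd S (\<lambda>i j. g \<alpha> (K i j))"
  using assms
proof (induction S arbitrary: g g' \<alpha> K rule: finite_induct)
  case empty
  show ?case by (simp add: kpsd_def)
next
  case (insert a S)
  obtain z where z: "\<And>i. i \<in> insert a S \<Longrightarrow> K a i = z a * z i"
    and R: "kpsd S (\<lambda>i j. K i j - z i * z j)"
    using kpsd_schur_complement[OF insert.hyps(1,2) insert.prems(4)] by blast
  have sym: "K i j = K j i" if "i \<in> insert a S" "j \<in> insert a S" for i j
    using insert.prems(4) that by (rule kpsd_sym)
  have "kpsd S (\<lambda>i j. g \<alpha> (K i j) - g \<alpha> (z i * z j))"
  proof (cases "card S \<le> 1")
    case True
    then consider "S = {}" | b where "S = {b}"
      using insert.hyps(1) by (metis card_1_singletonE card_0_eq le_eq_less_or_eq less_one)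
    then show ?thesis
    proof cases
      case 1
      then show ?thesis by (simp add: kpsd_def)
    next
      case (2 b)
      have "0 \<le> K b b - z b * z b"
        using kpsd_diag[OF insert.hyps(1) R] 2 by simp
      then have le: "z b * z b \<le> K b b" and "0 \<le> z b * z b" by auto
      then have "0 \<le> K b b" by (rule order_trans[rotated])
      then have "g \<alpha> (z b * z b) \<le> g \<alpha> (K b b)"
        using insert.prems le by (simp add: pow_pair_nonneg powr_mono2)
      then show ?thesis
        using 2 by (simp add: kpsd_def)
    qed
  next
    case False
    show ?thesis
    proof (rule kpsd_pow_diff[OF insert.hyps(1) insert.prems(1) _ R])
      \<comment> \<open>\<open>S\<close> has at least two elements, so \<alpha> \<ge>
        \<open>card S - 1\<close> \<ge> 1, and \<alpha> - 1 meets the bound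
        \<open>card S - 2\<close> of the induction hypothesis.\<close>
      show "1 \<le> \<alpha>"
        using False insert.hyps insert.prems(3) by simp
      show "kpsd S (\<lambda>i j. g' (\<alpha> - 1) (z i * z j + t * (K i j - z i * z j)))"
        if "t \<in> {0..1}" for t
        using False insert.hyps insert.prems(3) that
        by (intro insert.IH[OF pow_pair_sym[OF insert.prems(1)]] kpsd_add kpsd_scale R kpsd_rank_one) auto
    qed
  qed
  then have 1: "kpsd (insert a S) (\<lambda>i j. g \<alpha> (K i j) - g \<alpha> (z i * z j))"
    using insert.hyps z sym by (intro kpsd_insert_zero) (auto simp: mult.commute)
  \<comment> \<open>Powers are multiplicative, so \<open>g \<alpha>\<close> maps
    \<open>z z\<^sup>T\<close> to another rank one kernel.\<close>
  have 2: "kpsd (insert a S) (\<lambda>i j. g \<alpha> (z i) * g \<alpha> (z j))"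
    by (rule kpsd_rank_one)
  show ?case
    using kpsd_add[OF 1 2] by (simp add: pow_pair_mult[OF insert.prems(1)])
qed

text \<open>Every \<open>L + t (K - L)\<close> is positive semidefinite, so positivity of the other
  family at \<alpha> - 1 applies along the whole segment.\<close>

lemma kpsd_pow_mono:
  assumes S: "finite S" and g: "pow_pair g g'" and \<alpha>: "1 \<le> \<alpha>" "real (card S) - 1 \<le> \<alpha>"
    and L: "kpsd S L" and D: "kpsd S (\<lambda>i j. K i j - L i j)"
  shows "kpsd S (\<lambda>i j. g \<alpha> (K i j) - g \<alpha> (L i j))"
  by (rule kpsd_pow_diff[OF S g \<alpha>(1) D])
    (use \<alpha> in \<open>auto intro!: kpsd_pow[OF S pow_pair_sym[OF g]] kpsd_add L kpsd_scale D\<close>)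

text \<open>Subtract the integral along the segment from 0 to \<open>L\<close> from that along the
  segment from \<open>K\<close> to \<open>K + L\<close>. Both have direction \<open>L\<close>, and
  monotonicity at \<alpha> - 1 compares \<open>K + t L\<close> with \<open>t L\<close>.\<close>

lemma kpsd_pow_superadd:
  assumes S: "finite S" and g: "pow_pair g g'" and \<alpha>: "2 \<le> \<alpha>" "real (card S) \<le> \<alpha>"
    and K: "kpsd S K" and L: "kpsd S L"
  shows "kpsd S (\<lambda>i j. g \<alpha> (K i j + L i j) - (g \<alpha> (K i j) + g \<alpha> (L i j)))"
proof (rule kpsd_has_integral[OF S])
  have \<alpha>1: "1 \<le> \<alpha>" using \<alpha> by simp
  let ?F = "\<lambda>t i j. L i j * (g' (\<alpha> - 1) (K i j + t * L i j) - g' (\<alpha> - 1) (t * L i j))"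
  show "kpsd S (\<lambda>i j. \<alpha> * ?F t i j)" if "t \<in> {0..1}" for t
    by (intro kpsd_scale kpsd_schur_product kpsd_pow_mono[OF S pow_pair_sym[OF g]] S L)
      (use \<alpha> that K L in \<open>auto intro: kpsd_scale\<close>)
  show "((\<lambda>t. \<alpha> * ?F t i j) has_integral
      g \<alpha> (K i j + L i j) - (g \<alpha> (K i j) + g \<alpha> (L i j))) {0..1}" for i j
  proof -
    have "g \<alpha> 0 = 0"
      using pow_pair_nonneg[OF g, of 0] by simp
    then show ?thesis
      using has_integral_diff[OF pow_pair_has_integral[OF g \<alpha>1, of "L i j" "K i j"]
          pow_pair_has_integral[OF g \<alpha>1, of "L i j" 0]]
      by (simp add: algebra_simps)
  qed
qed

text \<open>With \<open>D = K - L\<close> and \<open>M = L + t D\<close>, the gap is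
  \<open>t (g[K] - g[M]) - (1 - t) (g[M] - g[L])\<close>. The segments have directions
  \<open>(1 - t) D\<close> and \<open>t D\<close>, so both integrals carry the factor
  \<open>t (1 - t)\<close>, and monotonicity at \<alpha> - 1 compares the integrands.\<close>

lemma kpsd_pow_convex:
  assumes S: "finite S" and g: "pow_pair g g'" and \<alpha>: "2 \<le> \<alpha>" "real (card S) \<le> \<alpha>"
    and t: "0 \<le> t" "t \<le> 1" and L: "kpsd S L" and D: "kpsd S (\<lambda>i j. K i j - L i j)"
  shows "kpsd S (\<lambda>i j. t * g \<alpha> (K i j) + (1 - t) * g \<alpha> (L i j) - g \<alpha> (t * K i j + (1 - t) * L i j))"
proof (rule kpsd_has_integral[OF S])
  have \<alpha>1: "1 \<le> \<alpha>" using \<alpha> by simp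
  let ?D = "\<lambda>i j. K i j - L i j"
  let ?F = "\<lambda>s i j. ?D i j * (g' (\<alpha> - 1) (L i j + t * ?D i j + s * ((1 - t) * ?D i j))
      - g' (\<alpha> - 1) (L i j + s * (t * ?D i j)))"
  show "kpsd S (\<lambda>i j. t * (1 - t) * (\<alpha> * ?F s i j))" if s: "s \<in> {0..1}" for s
  proof (intro kpsd_scale kpsd_schur_product kpsd_pow_mono[OF S pow_pair_sym[OF g]] S D)
    show "kpsd S (\<lambda>i j. L i j + s * (t * ?D i j))"
      using s t by (intro kpsd_add L kpsd_scale D) auto
    \<comment> \<open>This is \<open>t + s (1 - t) - s t\<close>, the coefficient of
      \<open>D\<close> in the difference of the two arguments, as a sum of nonnegative
      terms.\<close>
    have "0 \<le> t * (1 - s) + s * (1 - t)"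
      using s t by simp
    then have "kpsd S (\<lambda>i j. (t * (1 - s) + s * (1 - t)) * ?D i j)"
      by (intro kpsd_scale D)
    then show "kpsd S (\<lambda>i j. L i j + t * ?D i j + s * ((1 - t) * ?D i j) - (L i j + s * (t * ?D i j)))"
      by (simp add: algebra_simps)
  qed (use \<alpha> t in auto)
  show "((\<lambda>s. t * (1 - t) * (\<alpha> * ?F s i j)) has_integral
      t * g \<alpha> (K i j) + (1 - t) * g \<alpha> (L i j) - g \<alpha> (t * K i j + (1 - t) * L i j)) {0..1}" for i j
  proof -
    have 1: "L i j + t * ?D i j + (1 - t) * ?D i j = K i j"
      and 2: "L i j + t * ?D i j = t * K i j + (1 - t) * L i j"
      by (auto simp: algebra_simps)
    have aux: "t * (\<alpha> * ((1 - t) * d * p)) - (1 - t) * (\<alpha> * (t * d * q))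
        = t * (1 - t) * (\<alpha> * (d * (p - q)))" for d p q
      by (simp add: algebra_simps)
    have "((\<lambda>s. t * (\<alpha> * ((1 - t) * ?D i j * g' (\<alpha> - 1) (L i j + t * ?D i j + s * ((1 - t) * ?D i j))))
        - (1 - t) * (\<alpha> * (t * ?D i j * g' (\<alpha> - 1) (L i j + s * (t * ?D i j))))) has_integral
        t * (g \<alpha> (L i j + t * ?D i j + (1 - t) * ?D i j) - g \<alpha> (L i j + t * ?D i j))
        - (1 - t) * (g \<alpha> (L i j + t * ?D i j) - g \<alpha> (L i j))) {0..1}"
      by (intro has_integral_diff has_integral_mult_right pow_pair_has_integral[OF g \<alpha>1])
    moreover have "t * (g \<alpha> (K i j) - g \<alpha> (L i j + t * ?D i j)) - (1 - t) * (g \<alpha> (L i j + t * ?D i j) - g \<alpha> (L i j))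
        = t * g \<alpha> (K i j) + (1 - t) * g \<alpha> (L i j) - g \<alpha> (t * K i j + (1 - t) * L i j)"
      unfolding 2 by (simp add: algebra_simps)
    moreover have "(\<lambda>s. t * (\<alpha> * ((1 - t) * ?D i j * g' (\<alpha> - 1) (L i j + t * ?D i j + s * ((1 - t) * ?D i j))))
        - (1 - t) * (\<alpha> * (t * ?D i j * g' (\<alpha> - 1) (L i j + s * (t * ?D i j)))))
        = (\<lambda>s. t * (1 - t) * (\<alpha> * ?F s i j))"
      unfolding aux ..
    ultimately show ?thesis
      unfolding 1 by simp
  qed
qed

section \<open>Lower bounds\<close>

lemma psd_iff_kpsd: "psd A \<longleftrightarrow> kpsd UNIV (\<lambda>i j. A $ i $ j)"
proof -
  have form: "x \<bullet> (A *v x) = (\<Sum>i\<in>UNIV. \<Sum>j\<in>UNIV. x $ i * x $ j * A $ i $ j)" for x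
    by (simp add: inner_vec_def matrix_vector_mult_def sum_distrib_left mult_ac)
  have "(\<forall>x. 0 \<le> x \<bullet> (A *v x)) \<longleftrightarrow> (\<forall>c. 0 \<le> (\<Sum>i\<in>UNIV. \<Sum>j\<in>UNIV. c i * c j * A $ i $ j))"
    (is "?P \<longleftrightarrow> ?Q")
  proof
    assume ?P
    show ?Q
    proof
      fix c :: "'a \<Rightarrow> real"
      show "0 \<le> (\<Sum>i\<in>UNIV. \<Sum>j\<in>UNIV. c i * c j * A $ i $ j)"
        using \<open>?P\<close>[rule_format, of "\<chi> i. c i"] unfolding form by simp
    qed
  qed (simp add: form)
  moreover have "transpose A = A \<longleftrightarrow> (\<forall>i j. A $ i $ j = A $ j $ i)"
    by (auto simp: transpose_def vec_eq_iff)
  ultimately show ?thesis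
    by (simp add: psd_def kpsd_def)
qed

lemma psd_form_nonneg:
  "psd A \<Longrightarrow> 0 \<le> (\<Sum>i\<in>UNIV. \<Sum>j\<in>UNIV. c i * c j * A $ i $ j)"
  using kpsd_nonneg psd_iff_kpsd by blast

lemma rank_le_two:
  fixes u v :: "'n::finite \<Rightarrow> real"
  shows "rank (\<chi> i j. u i * u j + v i * v j :: real ^ 'n ^ 'n) \<le> 2"
proof -
  let ?A = "\<chi> i j. u i * u j + v i * v j :: real ^ 'n ^ 'n"
  let ?U = "\<chi> i. u i" and ?V = "\<chi> i. v i"
  have "column j ?A = u j *\<^sub>R ?U + v j *\<^sub>R ?V" for j
    by (simp add: column_def vec_eq_iff)
  then have "columns ?A \<subseteq> span {?U, ?V}"
    by (auto simp: columns_def intro!: span_add span_scale intro: span_base)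
  then have "dim (columns ?A) \<le> card {?U, ?V}"
    by (intro dim_le_card) auto
  also have "\<dots> \<le> 2"
    by (simp add: card_insert_if)
  finally show ?thesis
    by (simp add: column_rank_def)
qed

lemma rank_le_one:
  fixes u :: "'n::finite \<Rightarrow> real"
  shows "rank (\<chi> i j. u i * u j :: real ^ 'n ^ 'n) \<le> 1"
proof -
  let ?A = "\<chi> i j. u i * u j :: real ^ 'n ^ 'n"
  let ?U = "\<chi> i. u i"
  have "column j ?A = u j *\<^sub>R ?U" for j
    by (simp add: column_def vec_eq_iff)
  then have "columns ?A \<subseteq> span {?U}"
    by (auto simp: columns_def intro!: span_scale intro: span_base)
  then have "dim (columns ?A) \<le> card {?U}"
    by (intro dim_le_card) auto
  then show ?thesis
    by (simp add: column_rank_def)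
qed

lemma psd_rank_one: "psd (\<chi> i j. u i * u j)"
  by (simp add: psd_iff_kpsd kpsd_rank_one)

lemma psd_rank_two: "psd (\<chi> i j. u i * u j + v i * v j)"
  using kpsd_add[OF kpsd_rank_one kpsd_rank_one] by (simp add: psd_iff_kpsd)

lemma rank_one_mem:
  assumes "1 \<le> k" "{0..} \<subseteq> I" "\<And>i. 0 \<le> u i"
  shows "(\<chi> i j. u i * u j) \<in> psd_rank_le k I"
  using assms rank_le_one[of u]
  by (auto simp: psd_rank_le_def psd_rank_one entries_in_def subset_iff)

lemma rank_two_mem:
  assumes "2 \<le> k" "{0..} \<subseteq> I" "\<And>i. 0 \<le> u i" "\<And>i. 0 \<le> v i"
  shows "(\<chi> i j. u i * u j + v i * v j) \<in> psd_rank_le k I"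
  using assms rank_le_two[of u v]
  by (auto simp: psd_rank_le_def psd_rank_two entries_in_def subset_iff)

section \<open>Binomial expansions and test vectors\<close>

text \<open>Among the m + 2 factors \<alpha>, ..., \<alpha> - m - 1 of the numerator only the last
  is negative.\<close>

lemma gchoose_neg:
  fixes \<alpha> :: real
  assumes "real m < \<alpha>" "\<alpha> < real m + 1"
  shows "\<alpha> gchoose (m + 2) < 0"
proof -
  have "\<alpha> gchoose (m + 2) = (\<Prod>i<m + 2. \<alpha> - real i) / fact (m + 2)"
    by (simp add: gbinomial_prod_rev lessThan_atLeast0)
  also have "(\<Prod>i<m + 2. \<alpha> - real i) = (\<Prod>i<m + 1. \<alpha> - real i) * (\<alpha> - real (m + 1))"
    by simp
  also have "\<dots> / fact (m + 2) < 0"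
    using assms by (intro divide_neg_pos mult_pos_neg prod_pos) auto
  finally show ?thesis .
qed

text \<open>Nodes in (0, 1] keep \<open>\<epsilon> * (x i * x j)\<close> inside the disc of
  convergence of the binomial series whenever \<open>\<bar>\<epsilon>\<bar> < 1\<close>.\<close>

lemma obtain_nodes:
  obtains x :: "'n::finite \<Rightarrow> real" where "inj x" "\<And>i. 0 < x i" "\<And>i. x i \<le> 1"
proof -
  obtain e :: "'n \<Rightarrow> nat" where "inj e"
    using finite_imp_inj_to_nat_seg[of "UNIV :: 'n set"] by auto
  then show thesis
    by (intro that[of "\<lambda>i. 1 / (real (e i) + 1)"]) (auto simp: inj_def field_simps)
qed

text \<open>Existence is a dimension count. A functional that also kills the next power kills
  \<open>t\<^sup>p q(t)\<close> for every polynomial \<open>q\<close> of degree less than the number of nodes, hence vanishes.\<close>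

lemma obtain_orthogonal_to_powers:
  fixes x :: "'n::finite \<Rightarrow> real"
  assumes x: "inj x" "\<And>i. x i \<noteq> 0"
  obtains c where "\<And>m. p \<le> m \<Longrightarrow> Suc m < p + CARD('n) \<Longrightarrow> (\<Sum>i\<in>UNIV. c i * x i ^ m) = 0"
    and "(\<Sum>i\<in>UNIV. c i * x i ^ (p + CARD('n) - 1)) \<noteq> 0"
proof -
  let ?w = "\<lambda>m. (\<chi> i. x i ^ (p + m)) :: real ^ 'n"
  let ?n = "CARD('n)"
  have n: "0 < ?n" by simp
  have "dim (?w ` {..<?n - 1}) \<le> card (?w ` {..<?n - 1})"
    by (rule dim_le_card') simp
  also have "\<dots> \<le> ?n - 1"
    using card_image_le[of "{..<?n - 1}" ?w] by simp
  also have "\<dots> < DIM(real ^ 'n)"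
    using n by simp
  finally obtain y :: "real ^ 'n" where y: "y \<noteq> 0"
    and orth: "\<And>z. z \<in> span (?w ` {..<?n - 1}) \<Longrightarrow> orthogonal y z"
    using orthogonal_to_subspace_exists by blast
  have low: "(\<Sum>i\<in>UNIV. y $ i * x i ^ (p + m)) = 0" if "m < ?n - 1" for m
  proof -
    have "orthogonal y (?w m)"
      using that by (intro orth span_base) auto
    then show ?thesis
      by (simp add: orthogonal_def inner_vec_def)
  qed
  have "(\<Sum>i\<in>UNIV. y $ i * x i ^ (p + (?n - 1))) \<noteq> 0"
  proof
    assume top: "(\<Sum>i\<in>UNIV. y $ i * x i ^ (p + (?n - 1))) = 0"
    have all: "(\<Sum>i\<in>UNIV. y $ i * x i ^ (p + m)) = 0" if "m < ?n" for m
    proof (cases "m = ?n - 1")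
      case False
      then show ?thesis using that by (intro low) simp
    qed (use top in simp)
    obtain l where l: "y $ l \<noteq> 0"
      using y by (auto simp: vec_eq_iff)
    \<comment> \<open>\<open>?q\<close> vanishes at every node except \<open>x l\<close>, so pairing
      with it isolates \<open>y $ l\<close>.\<close>
    let ?q = "\<Prod>j\<in>UNIV - {l}. [:- x j, 1:]"
    have deg: "degree ?q = ?n - 1"
      by (subst degree_prod_eq_sum_degree) (auto simp: card_Diff_singleton)
    have "(\<Sum>i\<in>UNIV. y $ i * x i ^ p * poly ?q (x i))
        = (\<Sum>i\<in>UNIV. \<Sum>m\<le>?n - 1. coeff ?q m * (y $ i * x i ^ (p + m)))"
      unfolding poly_altdef deg by (simp add: sum_distrib_left power_add mult_ac)
    also have "\<dots> = (\<Sum>m\<le>?n - 1. coeff ?q m * (\<Sum>i\<in>UNIV. y $ i * x i ^ (p + m)))"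
      by (subst sum.swap) (simp add: sum_distrib_left)
    also have "\<dots> = 0"
    proof (intro sum.neutral ballI)
      fix m assume "m \<in> {..?n - 1}"
      then have "m < ?n" using n unfolding atMost_iff by linarith
      then show "coeff ?q m * (\<Sum>i\<in>UNIV. y $ i * x i ^ (p + m)) = 0"
        using all by simp
    qed
    also have "(\<Sum>i\<in>UNIV. y $ i * x i ^ p * poly ?q (x i))
        = (\<Sum>i\<in>{l}. y $ i * x i ^ p * poly ?q (x i))"
      by (intro sum.mono_neutral_right) (auto simp: poly_prod)
    finally have "poly ?q (x l) = 0"
      using l x by simp
    then show False
      using x(1) by (auto simp: poly_prod inj_def)
  qed
  moreover have "(\<Sum>i\<in>UNIV. y $ i * x i ^ m) = 0" if "p \<le> m" "Suc m < p + ?n" for m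
    using low[of "m - p"] that by simp
  ultimately show thesis
    using that[of "\<lambda>i. y $ i"] n by (metis Nat.add_diff_assoc Suc_leI One_nat_def)
qed

text \<open>The terms \<open>c i * c j * (x i * x j) ^ m\<close> add up to a square. Hence a
  coefficient vanishes when \<open>c\<close> is orthogonal to the m-th powers, and otherwise its
  sign is decided by the binomial coefficient.\<close>

lemma binomial_form_sums:
  fixes x c :: "'n::finite \<Rightarrow> real"
  assumes x: "\<And>i. 0 < x i" "\<And>i. x i \<le> 1" and \<epsilon>: "\<bar>\<epsilon>\<bar> < 1"
  shows "(\<lambda>m. (\<alpha> gchoose m) * (\<Sum>i\<in>UNIV. c i * x i ^ m)\<^sup>2 * \<epsilon> ^ m) sums
    (\<Sum>i\<in>UNIV. \<Sum>j\<in>UNIV. c i * c j * (1 + \<epsilon> * (x i * x j)) powr \<alpha>)"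
proof -
  have "(\<lambda>m. \<Sum>i\<in>UNIV. \<Sum>j\<in>UNIV. c i * c j * ((\<alpha> gchoose m) * (\<epsilon> * (x i * x j)) ^ m)) sums
    (\<Sum>i\<in>UNIV. \<Sum>j\<in>UNIV. c i * c j * (1 + \<epsilon> * (x i * x j)) powr \<alpha>)"
  proof (intro sums_sum sums_mult gen_binomial_real)
    fix i j
    have "\<bar>\<epsilon> * (x i * x j)\<bar> = \<bar>\<epsilon>\<bar> * (x i * x j)"
      using x[of i] x[of j] by (simp add: abs_mult)
    also have "\<dots> \<le> \<bar>\<epsilon>\<bar> * 1"
      using x[of i] x[of j] by (intro mult_left_mono mult_le_one) auto
    finally show "\<bar>\<epsilon> * (x i * x j)\<bar> < 1"
      using \<epsilon> by simp
  qed
  moreover have "(\<Sum>i\<in>UNIV. \<Sum>j\<in>UNIV. c i * c j * ((\<alpha> gchoose m) * (\<epsilon> * (x i * x j)) ^ m))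
      = (\<alpha> gchoose m) * (\<Sum>i\<in>UNIV. c i * x i ^ m)\<^sup>2 * \<epsilon> ^ m" for m
    by (simp add: power2_eq_square sum_product sum_distrib_left sum_distrib_right
        power_mult_distrib mult_ac)
  ultimately show ?thesis by simp
qed

text \<open>Dividing by \<open>\<epsilon> ^ N\<close> leaves a power series with constant term
  \<open>a N\<close>.\<close>

lemma powser_leading_term:
  fixes a :: "nat \<Rightarrow> real"
  assumes a: "\<And>m. m < N \<Longrightarrow> a m = 0"
    and sums: "\<And>\<epsilon>. \<bar>\<epsilon>\<bar> < 1 \<Longrightarrow> (\<lambda>m. a m * \<epsilon> ^ m) sums H \<epsilon>"
  shows "((\<lambda>\<epsilon>. H \<epsilon> / \<epsilon> ^ N) \<longlongrightarrow> a N) (at_right 0)"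
proof -
  have "((\<lambda>\<epsilon>. H \<epsilon> / \<epsilon> ^ N) \<longlongrightarrow> (\<lambda>m. a (m + N)) 0) (at 0)"
  proof (rule powser_limit_0_strong[of 1])
    fix \<epsilon> :: real assume \<epsilon>: "\<epsilon> \<noteq> 0" "norm \<epsilon> < 1"
    have "(\<lambda>m. a (m + N) * \<epsilon> ^ (m + N)) sums (H \<epsilon> - (\<Sum>m<N. a m * \<epsilon> ^ m))"
      using sums[of \<epsilon>] \<epsilon> by (intro sums_split_initial_segment) simp
    then have "(\<lambda>m. a (m + N) * \<epsilon> ^ (m + N) / \<epsilon> ^ N) sums (H \<epsilon> / \<epsilon> ^ N)"
      using a by (intro sums_divide) simp
    then show "(\<lambda>m. a (m + N) * \<epsilon> ^ m) sums (H \<epsilon> / \<epsilon> ^ N)"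
      using \<epsilon> by (simp add: power_add)
  qed simp
  then show ?thesis
    by (simp add: filterlim_at_split)
qed

lemma eventually_at_right_unit: "\<forall>\<^sub>F \<epsilon> in at_right (0::real). \<epsilon> \<in> {0<..<1}"
  by (rule eventually_at_right_real) simp

lemma powser_leading_coeff_nonneg:
  fixes a :: "nat \<Rightarrow> real"
  assumes a: "\<And>m. m < N \<Longrightarrow> a m = 0"
    and sums: "\<And>\<epsilon>. \<bar>\<epsilon>\<bar> < 1 \<Longrightarrow> (\<lambda>m. a m * \<epsilon> ^ m) sums H \<epsilon>"
    and nonneg: "\<And>\<epsilon>. \<epsilon> \<in> {0<..<1} \<Longrightarrow> 0 \<le> H \<epsilon>"
  shows "0 \<le> a N"
  using powser_leading_term[OF a sums]
proof (rule tendsto_lowerbound)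
  show "\<forall>\<^sub>F \<epsilon> in at_right 0. 0 \<le> H \<epsilon> / \<epsilon> ^ N"
    using eventually_at_right_unit by eventually_elim (use nonneg in auto)
qed auto

text \<open>\<open>H \<epsilon> / \<epsilon> powr \<alpha>\<close> is at least \<open>C\<close>, but
  tends to 0 because \<open>H\<close> has order at least \<open>N\<close> and \<alpha> <
  \<open>N\<close>.\<close>

lemma powser_not_ge_powr:
  fixes a :: "nat \<Rightarrow> real"
  assumes a: "\<And>m. m < N \<Longrightarrow> a m = 0"
    and sums: "\<And>\<epsilon>. \<bar>\<epsilon>\<bar> < 1 \<Longrightarrow> (\<lambda>m. a m * \<epsilon> ^ m) sums H \<epsilon>"
    and ge: "\<And>\<epsilon>. \<epsilon> \<in> {0<..<1} \<Longrightarrow> C * \<epsilon> powr \<alpha> \<le> H \<epsilon>"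
    and \<alpha>: "\<alpha> < real N"
  shows "C \<le> 0"
proof -
  have "((\<lambda>\<epsilon>::real. \<epsilon> powr (real N - \<alpha>)) \<longlongrightarrow> 0 powr (real N - \<alpha>)) (at_right 0)"
    using \<alpha> by (intro tendsto_powr' tendsto_ident_at tendsto_const)
      (auto simp: eventually_at_filter)
  with powser_leading_term[OF a sums]
  have "((\<lambda>\<epsilon>. H \<epsilon> / \<epsilon> ^ N * \<epsilon> powr (real N - \<alpha>)) \<longlongrightarrow> a N * 0 powr (real N - \<alpha>)) (at_right 0)"
    by (rule tendsto_mult)
  then have lim: "((\<lambda>\<epsilon>. H \<epsilon> / \<epsilon> ^ N * \<epsilon> powr (real N - \<alpha>)) \<longlongrightarrow> 0) (at_right 0)"
    by simp
  show ?thesis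
    using lim
  proof (rule tendsto_lowerbound)
    show "\<forall>\<^sub>F \<epsilon> in at_right 0. C \<le> H \<epsilon> / \<epsilon> ^ N * \<epsilon> powr (real N - \<alpha>)"
      using eventually_at_right_unit
    proof eventually_elim
      case (elim \<epsilon>)
      then have "H \<epsilon> / \<epsilon> ^ N * \<epsilon> powr (real N - \<alpha>) = H \<epsilon> / \<epsilon> powr \<alpha>"
        by (simp add: powr_diff powr_realpow)
      then show ?case
        using ge[OF elim] elim by (simp add: pos_le_divide_eq)
    qed
  qed auto
qed


section \<open>Counterexamples below the critical exponents\<close>

text \<open>The sum of the all-ones matrix and \<open>\<epsilon> x x\<^sup>T\<close>. For positive
  \<open>x\<close> and \<epsilon> \<ge> 0 it has rank at most two, increases with \<epsilon> in the
  Loewner order, and has positive entries, where all three families agree.\<close>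

definition test_matrix :: "('n \<Rightarrow> real) \<Rightarrow> real \<Rightarrow> real ^ 'n ^ 'n" where
  "test_matrix x \<epsilon> = (\<chi> i j. 1 + \<epsilon> * (x i * x j))"

lemma test_matrix_mem:
  assumes "2 \<le> k" "{0..} \<subseteq> I" "\<And>i. 0 < x i" "0 \<le> \<epsilon>"
  shows "test_matrix x \<epsilon> \<in> psd_rank_le k I"
proof -
  have "test_matrix x \<epsilon> = (\<chi> i j. 1 * 1 + sqrt \<epsilon> * x i * (sqrt \<epsilon> * x j))"
    using assms(4) by (simp add: test_matrix_def vec_eq_iff)
  then show ?thesis
    using assms rank_two_mem[of k I "\<lambda>_. 1" "\<lambda>i. sqrt \<epsilon> * x i"] by (simp add: less_imp_le)
qed

lemma test_matrix_loewner:
  assumes "\<delta> \<le> \<epsilon>"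
  shows "test_matrix x \<delta> \<preceq>\<^sub>L test_matrix x \<epsilon>"
proof -
  have "kpsd UNIV (\<lambda>i j. (\<epsilon> - \<delta>) * (x i * x j))"
    using assms by (intro kpsd_scale kpsd_rank_one) simp
  then show ?thesis
    by (simp add: loewner_le_def psd_iff_kpsd test_matrix_def algebra_simps)
qed

lemma test_matrix_zero_loewner: "0 \<preceq>\<^sub>L test_matrix x 0"
  using psd_rank_one[of "\<lambda>_. 1"] by (simp add: loewner_le_def test_matrix_def)

lemma test_matrix_entry:
  assumes "\<And>y. 0 \<le> y \<Longrightarrow> f y = y powr \<alpha>" "\<And>i. 0 < x i" "0 \<le> \<epsilon>"
  shows "f (test_matrix x \<epsilon> $ i $ j) = (1 + \<epsilon> * (x i * x j)) powr \<alpha>"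
  using assms by (simp add: test_matrix_def less_imp_le)

text \<open>As n - 1 = m + 2, the vector \<open>c\<close> can kill the powers 0 to m + 1; the
  expansion then starts at order m + 2 with a negative binomial coefficient.\<close>

lemma not_hadamard_positive:
  fixes V :: "(real ^ 'n ^ 'n) set"
  assumes f: "\<And>y. 0 \<le> y \<Longrightarrow> f y = y powr \<alpha>" and I: "{0..} \<subseteq> I"
    and V: "V = psd_rank_le k I" "2 \<le> k"
    and n: "CARD('n) = m + 3" and \<alpha>: "real m < \<alpha>" "\<alpha> < real m + 1"
  shows "\<not> hadamard_positive V f"
proof
  assume pos: "hadamard_positive V f"
  obtain x :: "'n \<Rightarrow> real" where x: "inj x" "\<And>i. 0 < x i" "\<And>i. x i \<le> 1"
    using obtain_nodes by blast
  then have x0: "x i \<noteq> 0" for i by (metis less_irrefl)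
  obtain c where c: "\<And>l. l < m + 2 \<Longrightarrow> (\<Sum>i\<in>UNIV. c i * x i ^ l) = 0"
      "(\<Sum>i\<in>UNIV. c i * x i ^ (m + 2)) \<noteq> 0"
    using obtain_orthogonal_to_powers[OF x(1) x0, of 0] n by auto
  have "0 \<le> (\<alpha> gchoose (m + 2)) * (\<Sum>i\<in>UNIV. c i * x i ^ (m + 2))\<^sup>2"
  proof (rule powser_leading_coeff_nonneg[OF _ binomial_form_sums[OF x(2,3)]])
    show "(\<alpha> gchoose l) * (\<Sum>i\<in>UNIV. c i * x i ^ l)\<^sup>2 = 0" if "l < m + 2" for l
      using c(1)[OF that] by simp
    fix \<epsilon> :: real assume "\<epsilon> \<in> {0<..<1}"
    then have \<epsilon>: "0 \<le> \<epsilon>" by simp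
    have "psd (map_matrix f (test_matrix x \<epsilon>))"
      using pos test_matrix_mem[where x=x, OF V(2) I x(2) \<epsilon>] V(1)
      by (auto simp: hadamard_positive_def loewner_le_def)
    from psd_form_nonneg[OF this, of c]
    show "0 \<le> (\<Sum>i\<in>UNIV. \<Sum>j\<in>UNIV. c i * c j * (1 + \<epsilon> * (x i * x j)) powr \<alpha>)"
      by (simp add: test_matrix_entry[where x=x, OF f x(2) \<epsilon>])
  qed
  then show False
    using gchoose_neg[OF \<alpha>] c(2) by (simp add: zero_le_mult_iff)
qed

text \<open>The factor \<open>1 - 0 ^ m\<close> deletes the constant term, which is the value of the
  form at \<epsilon> = 0.\<close>

lemma binomial_form_diff_sums:
  fixes x c :: "'n::finite \<Rightarrow> real"
  assumes x: "\<And>i. 0 < x i" "\<And>i. x i \<le> 1" and \<epsilon>: "\<bar>\<epsilon>\<bar> < 1"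
  shows "(\<lambda>m. (1 - 0 ^ m) * ((\<alpha> gchoose m) * (\<Sum>i\<in>UNIV. c i * x i ^ m)\<^sup>2) * \<epsilon> ^ m) sums
    (\<Sum>i\<in>UNIV. \<Sum>j\<in>UNIV. c i * c j * ((1 + \<epsilon> * (x i * x j)) powr \<alpha> - 1))"
proof -
  have "(\<lambda>m. (1 - 0 ^ m) * ((\<alpha> gchoose m) * (\<Sum>i\<in>UNIV. c i * x i ^ m)\<^sup>2) * \<epsilon> ^ m)
      = (\<lambda>m. (\<alpha> gchoose m) * (\<Sum>i\<in>UNIV. c i * x i ^ m)\<^sup>2 * \<epsilon> ^ m
        - (\<alpha> gchoose m) * (\<Sum>i\<in>UNIV. c i * x i ^ m)\<^sup>2 * 0 ^ m)"
    by (auto simp: fun_eq_iff power_0_left)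
  then show ?thesis
    using sums_diff[OF binomial_form_sums[OF x \<epsilon>, of \<alpha> c] binomial_form_sums[OF x, of 0 \<alpha> c]]
    by (simp add: right_diff_distrib sum_subtractf)
qed

text \<open>Subtracting the value at \<epsilon> = 0 cancels order 0, so the n - 1 = m + 1
  orthogonality conditions can be spent on the powers 1 to m + 1.\<close>

lemma not_hadamard_monotone:
  fixes V :: "(real ^ 'n ^ 'n) set"
  assumes f: "\<And>y. 0 \<le> y \<Longrightarrow> f y = y powr \<alpha>" and I: "{0..} \<subseteq> I"
    and V: "V = psd_rank_le k I" "2 \<le> k"
    and n: "CARD('n) = m + 2" and \<alpha>: "real m < \<alpha>" "\<alpha> < real m + 1"
  shows "\<not> hadamard_monotone V f"
proof
  assume mono: "hadamard_monotone V f"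
  obtain x :: "'n \<Rightarrow> real" where x: "inj x" "\<And>i. 0 < x i" "\<And>i. x i \<le> 1"
    using obtain_nodes by blast
  then have x0: "x i \<noteq> 0" for i by (metis less_irrefl)
  obtain c where c: "\<And>l. 1 \<le> l \<Longrightarrow> l < m + 2 \<Longrightarrow> (\<Sum>i\<in>UNIV. c i * x i ^ l) = 0"
      "(\<Sum>i\<in>UNIV. c i * x i ^ (m + 2)) \<noteq> 0"
    using obtain_orthogonal_to_powers[OF x(1) x0, of 1] n by auto
  have "0 \<le> (1 - 0 ^ (m + 2)) * ((\<alpha> gchoose (m + 2)) * (\<Sum>i\<in>UNIV. c i * x i ^ (m + 2))\<^sup>2)"
  proof (rule powser_leading_coeff_nonneg[OF _ binomial_form_diff_sums[OF x(2,3)]])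
    show "(1 - 0 ^ l) * ((\<alpha> gchoose l) * (\<Sum>i\<in>UNIV. c i * x i ^ l)\<^sup>2) = 0" if "l < m + 2" for l
      using c(1)[of l] that by (cases l) auto
    fix \<epsilon> :: real assume "\<epsilon> \<in> {0<..<1}"
    then have \<epsilon>: "0 \<le> \<epsilon>" by simp
    have "psd (map_matrix f (test_matrix x \<epsilon>) - map_matrix f (test_matrix x 0))"
      using mono test_matrix_mem[where x=x, OF V(2) I x(2)] \<epsilon> V(1) test_matrix_zero_loewner[of x]
        test_matrix_loewner[OF \<epsilon>, of x]
      by (simp add: hadamard_monotone_def loewner_le_def)
    from psd_form_nonneg[OF this, of c]
    show "0 \<le> (\<Sum>i\<in>UNIV. \<Sum>j\<in>UNIV. c i * c j * ((1 + \<epsilon> * (x i * x j)) powr \<alpha> - 1))"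
      using \<epsilon> by (simp add: test_matrix_entry[where x=x, OF f x(2)])
  qed
  then show False
    using gchoose_neg[OF \<alpha>] c(2) by (simp add: zero_le_mult_iff)
qed

text \<open>The midpoint gap between parameters \<epsilon> and 0 cancels orders 0 and 1, so the n -
  1 = m conditions go to the powers 2 to m + 1.\<close>

lemma not_hadamard_convex:
  fixes V :: "(real ^ 'n ^ 'n) set"
  assumes f: "\<And>y. 0 \<le> y \<Longrightarrow> f y = y powr \<alpha>" and I: "{0..} \<subseteq> I"
    and V: "V = psd_rank_le k I" "2 \<le> k"
    and n: "CARD('n) = m + 1" and \<alpha>: "real m < \<alpha>" "\<alpha> < real m + 1"
  shows "\<not> hadamard_convex V f"
proof
  assume conv: "hadamard_convex V f"
  obtain x :: "'n \<Rightarrow> real" where x: "inj x" "\<And>i. 0 < x i" "\<And>i. x i \<le> 1"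
    using obtain_nodes by blast
  then have x0: "x i \<noteq> 0" for i by (metis less_irrefl)
  obtain c where c: "\<And>l. 2 \<le> l \<Longrightarrow> l < m + 2 \<Longrightarrow> (\<Sum>i\<in>UNIV. c i * x i ^ l) = 0"
      "(\<Sum>i\<in>UNIV. c i * x i ^ (m + 2)) \<noteq> 0"
    using obtain_orthogonal_to_powers[OF x(1) x0, of 2] n by auto
  let ?b = "\<lambda>l. (\<alpha> gchoose l) * (\<Sum>i\<in>UNIV. c i * x i ^ l)\<^sup>2"
  \<comment> \<open>The first factor is the weight of order \<open>l\<close> in the midpoint gap: it
    is 0 for \<open>l = 0\<close> and \<open>l = 1\<close>, and positive afterwards.\<close>
  let ?a = "\<lambda>l. (1/2 + 1/2 * 0 ^ l - (1/2) ^ l) * ?b l"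
  let ?q = "\<lambda>\<epsilon>. \<Sum>i\<in>UNIV. \<Sum>j\<in>UNIV. c i * c j * (1 + \<epsilon> * (x i * x j)) powr \<alpha>"
  have "0 \<le> ?a (m + 2)"
  proof (rule powser_leading_coeff_nonneg[of "m + 2" ?a "\<lambda>\<epsilon>. 1/2 * ?q \<epsilon> + 1/2 * ?q 0 - ?q (\<epsilon> / 2)"])
    show "?a l = 0" if "l < m + 2" for l
    proof (cases "l < 2")
      case True
      then have "l = 0 \<or> l = 1" by auto
      then show ?thesis by auto
    qed (use c(1)[of l] that in simp)
    show "(\<lambda>l. ?a l * \<epsilon> ^ l) sums (1/2 * ?q \<epsilon> + 1/2 * ?q 0 - ?q (\<epsilon> / 2))" if "\<bar>\<epsilon>\<bar> < 1" for \<epsilon>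
    proof -
      have "(\<lambda>l. 1/2 * (?b l * \<epsilon> ^ l) + 1/2 * (?b l * 0 ^ l) - ?b l * (\<epsilon> / 2) ^ l) sums
          (1/2 * ?q \<epsilon> + 1/2 * ?q 0 - ?q (\<epsilon> / 2))"
        using that by (intro sums_diff sums_add sums_mult binomial_form_sums x) auto
      moreover have "1/2 * (?b l * \<epsilon> ^ l) + 1/2 * (?b l * 0 ^ l) - ?b l * (\<epsilon> / 2) ^ l = ?a l * \<epsilon> ^ l" for l
        by (cases "l = 0") (simp_all add: power_divide field_simps)
      ultimately show ?thesis by simp
    qed
    fix \<epsilon> :: real assume "\<epsilon> \<in> {0<..<1}"
    then have \<epsilon>: "0 \<le> \<epsilon>" by simp
    let ?M = "\<lambda>\<epsilon>. map_matrix f (test_matrix x \<epsilon>)"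
    have mid: "(1/2) *\<^sub>R test_matrix x \<epsilon> + (1 - 1/2) *\<^sub>R test_matrix x 0 = test_matrix x (\<epsilon> / 2)"
      by (simp add: test_matrix_def vec_eq_iff field_simps)
    have "psd ((1/2) *\<^sub>R ?M \<epsilon> + (1 - 1/2) *\<^sub>R ?M 0 - ?M (\<epsilon> / 2))"
      using conv[unfolded hadamard_convex_def, rule_format, of "test_matrix x \<epsilon>" "test_matrix x 0" "1/2"]
        test_matrix_mem[where x=x, OF V(2) I x(2)] \<epsilon> V(1) test_matrix_zero_loewner[of x]
        test_matrix_loewner[OF \<epsilon>, of x]
      unfolding mid loewner_le_def by simp
    from psd_form_nonneg[OF this, of c] \<epsilon>
    have "0 \<le> (\<Sum>i\<in>UNIV. \<Sum>j\<in>UNIV. c i * c j * (1/2 * (1 + \<epsilon> * (x i * x j)) powr \<alpha>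
        + 1/2 * (1 + 0 * (x i * x j)) powr \<alpha> - (1 + \<epsilon> / 2 * (x i * x j)) powr \<alpha>))"
      by (simp add: test_matrix_entry[where x=x, OF f x(2)])
    also have "\<dots> = 1/2 * ?q \<epsilon> + 1/2 * ?q 0 - ?q (\<epsilon> / 2)"
      unfolding right_diff_distrib distrib_left sum_subtractf sum.distrib sum_distrib_left
      by (simp only: mult_ac)
    finally show "0 \<le> 1/2 * ?q \<epsilon> + 1/2 * ?q 0 - ?q (\<epsilon> / 2)" .
  qed
  moreover have "(1/2 :: real) ^ (m + 2) < 1/2"
  proof -
    have "(1/2 :: real) ^ (m + 2) = (1/2) ^ m * (1/4)"
      by (simp add: power_add power2_eq_square)
    moreover have "(1/2 :: real) ^ m \<le> 1"
      by (simp add: power_le_one)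
    ultimately show ?thesis by simp
  qed
  ultimately show False
    using gchoose_neg[OF \<alpha>] c(2) by (simp add: zero_le_mult_iff)
qed

text \<open>Test the all-ones matrix and \<open>\<epsilon> x x\<^sup>T\<close> against a
  \<open>c\<close> that kills the powers 1 to n - 1. The form of the powers of
  \<open>1 + \<epsilon> * (x i * x j)\<close> minus 1 has order at least n, whereas the power of the
  second matrix contributes a square times \<open>\<epsilon> powr \<alpha>\<close>, which dominates
  when \<alpha> < n.\<close>

lemma eventually_not_hadamard_superadditive:
  fixes V :: "(real ^ 'n ^ 'n) set"
  assumes g: "\<And>\<alpha> y. 0 \<le> y \<Longrightarrow> g \<alpha> y = y powr \<alpha>" and I: "{0..} \<subseteq> I"
    and V: "V = psd_rank_le k I" "1 \<le> k"
  shows "\<forall>\<^sub>F \<alpha> in at_left (real CARD('n)). \<not> hadamard_superadditive I V (g \<alpha>)"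
proof -
  let ?n = "CARD('n)"
  obtain x :: "'n \<Rightarrow> real" where x: "inj x" "\<And>i. 0 < x i" "\<And>i. x i \<le> 1"
    using obtain_nodes by blast
  then have x0: "x i \<noteq> 0" for i by (metis less_irrefl)
  obtain c where c: "\<And>l. 1 \<le> l \<Longrightarrow> l < ?n \<Longrightarrow> (\<Sum>i\<in>UNIV. c i * x i ^ l) = 0"
      "(\<Sum>i\<in>UNIV. c i * x i ^ ?n) \<noteq> 0"
    using obtain_orthogonal_to_powers[OF x(1) x0, of 1] by auto
  let ?C = "\<lambda>\<alpha>. \<Sum>i\<in>UNIV. c i * x i powr \<alpha>"
  \<comment> \<open>\<open>c\<close> does not depend on \<alpha>, so its nonzero pairing with the
    n-th powers persists by continuity for \<alpha> just below n.\<close>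
  have "(?C \<longlongrightarrow> ?C (real ?n)) (at_left (real ?n))"
    by (intro tendsto_sum tendsto_mult tendsto_const tendsto_powr tendsto_ident_at x0)
  moreover have "?C (real ?n) \<noteq> 0"
    using c(2) x(2) by (simp add: powr_realpow)
  ultimately have "\<forall>\<^sub>F \<alpha> in at_left (real ?n). ?C \<alpha> \<noteq> 0"
    by (rule tendsto_imp_eventually_ne)
  moreover have "\<forall>\<^sub>F \<alpha> in at_left (real ?n). \<alpha> < real ?n"
    by (simp add: eventually_at_filter)
  ultimately show ?thesis
  proof eventually_elim
    case (elim \<alpha>)
    show ?case
    proof
      assume super: "hadamard_superadditive I V (g \<alpha>)"
      have "(?C \<alpha>)\<^sup>2 \<le> 0"
      proof (rule powser_not_ge_powr[OF _ binomial_form_diff_sums[OF x(2,3)] _ elim(2)])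
        show "(1 - 0 ^ l) * ((\<alpha> gchoose l) * (\<Sum>i\<in>UNIV. c i * x i ^ l)\<^sup>2) = 0" if "l < ?n" for l
          using c(1)[of l] that by (cases l) auto
        fix \<epsilon> :: real assume "\<epsilon> \<in> {0<..<1}"
        then have \<epsilon>: "0 < \<epsilon>" by simp
        have C: "(?C \<alpha>)\<^sup>2 * \<epsilon> powr \<alpha>
            = (\<Sum>i\<in>UNIV. \<Sum>j\<in>UNIV. c i * c j * (\<epsilon> powr \<alpha> * (x i powr \<alpha> * x j powr \<alpha>)))"
          unfolding power2_eq_square sum_product
          by (simp add: sum_distrib_left sum_distrib_right mult_ac)
        \<comment> \<open>Both matrices are written in the product form that
          \<open>rank_one_mem\<close> expects.\<close>
        let ?A = "(\<chi> i j. 1 * 1) :: real ^ 'n ^ 'n"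
        let ?B = "(\<chi> i j. sqrt \<epsilon> * x i * (sqrt \<epsilon> * x j)) :: real ^ 'n ^ 'n"
        have B: "?B = (\<chi> i j. \<epsilon> * (x i * x j))"
          using \<epsilon> by (simp add: vec_eq_iff)
        have "?A \<in> V" "?B \<in> V"
          unfolding V(1) using V(2) I x(2) \<epsilon> by (intro rank_one_mem; simp add: less_imp_le)+
        moreover have "entries_in I (?A + ?B)"
          using I \<epsilon> x(2) unfolding B by (auto simp: entries_in_def subset_iff less_imp_le)
        ultimately have "psd (map_matrix (g \<alpha>) (?A + ?B) - (map_matrix (g \<alpha>) ?A + map_matrix (g \<alpha>) ?B))"
          using super by (auto simp: hadamard_superadditive_def loewner_le_def)
        from psd_form_nonneg[OF this, of c]
        have "0 \<le> (\<Sum>i\<in>UNIV. \<Sum>j\<in>UNIV. c i * c j *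
            ((1 + \<epsilon> * (x i * x j)) powr \<alpha> - 1 - \<epsilon> powr \<alpha> * (x i powr \<alpha> * x j powr \<alpha>)))"
          unfolding B using \<epsilon> x(2)
          by (simp add: g less_imp_le powr_mult diff_diff_eq)
        also have "\<dots> = (\<Sum>i\<in>UNIV. \<Sum>j\<in>UNIV. c i * c j * ((1 + \<epsilon> * (x i * x j)) powr \<alpha> - 1))
            - (?C \<alpha>)\<^sup>2 * \<epsilon> powr \<alpha>"
          unfolding C right_diff_distrib[of "c _ * c _" "_ - _"] sum_subtractf ..
        finally show "(?C \<alpha>)\<^sup>2 * \<epsilon> powr \<alpha>
            \<le> (\<Sum>i\<in>UNIV. \<Sum>j\<in>UNIV. c i * c j * ((1 + \<epsilon> * (x i * x j)) powr \<alpha> - 1))"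
          by simp
      qed
      then show False
        using elim(1) by simp
    qed
  qed
qed

section \<open>The critical exponents\<close>

text \<open>Agreement of \<open>f\<close> and \<open>h\<close> is asked only on \<open>I\<close>, so
  that \<open>f_pow\<close> on nonnegative entries is covered through
  \<open>phi_pow\<close>.\<close>

lemma hadamard_positive_pow:
  fixes V :: "(real ^ 'n ^ 'n) set"
  assumes h: "pow_pair h h'" and f: "\<And>y. y \<in> I \<Longrightarrow> f y = h \<alpha> y" and V: "V = psd_rank_le k I"
    and \<alpha>: "0 \<le> \<alpha>" "real CARD('n) - 2 \<le> \<alpha>"
  shows "hadamard_positive V f"
  using kpsd_pow[OF finite h \<alpha>] f
  by (auto simp: hadamard_positive_def loewner_le_def V psd_rank_le_def entries_in_def
      psd_iff_kpsd)

lemma hadamard_monotone_pow: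
  fixes V :: "(real ^ 'n ^ 'n) set"
  assumes h: "pow_pair h h'" and f: "\<And>y. y \<in> I \<Longrightarrow> f y = h \<alpha> y" and V: "V = psd_rank_le k I"
    and \<alpha>: "1 \<le> \<alpha>" "real CARD('n) - 1 \<le> \<alpha>"
  shows "hadamard_monotone V f"
  using kpsd_pow_mono[OF finite h \<alpha>] f
  by (auto simp: hadamard_monotone_def loewner_le_def V psd_rank_le_def entries_in_def
      psd_iff_kpsd)

lemma hadamard_convex_pow:
  fixes V :: "(real ^ 'n ^ 'n) set"
  assumes h: "pow_pair h h'" and f: "\<And>y. y \<in> I \<Longrightarrow> f y = h \<alpha> y" and V: "V = psd_rank_le k I"
    and I: "convex I" and \<alpha>: "2 \<le> \<alpha>" "real CARD('n) \<le> \<alpha>"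
  shows "hadamard_convex V f"
  unfolding hadamard_convex_def
proof (intro allI ballI impI; elim conjE)
  fix t :: real and A B
  assume A: "A \<in> V" and B: "B \<in> V" and t: "0 \<le> t" "t \<le> 1" and AB: "B \<preceq>\<^sub>L A"
  have ent: "A $ i $ j \<in> I" "B $ i $ j \<in> I" for i j
    using A B by (auto simp: V psd_rank_le_def entries_in_def)
  \<comment> \<open>Convexity of \<open>I\<close> keeps the entries of the mixture where
    \<open>f\<close> and \<open>h\<close> agree.\<close>
  moreover have "t * A $ i $ j + (1 - t) * B $ i $ j \<in> I" for i j
    using convexD[OF I ent[of i j], of t "1 - t"] t by simp
  ultimately show "map_matrix f (t *\<^sub>R A + (1 - t) *\<^sub>R B)
      \<preceq>\<^sub>L t *\<^sub>R map_matrix f A + (1 - t) *\<^sub>R map_matrix f B"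
    using kpsd_pow_convex[OF finite h \<alpha> t, of "\<lambda>i j. B $ i $ j" "\<lambda>i j. A $ i $ j"] AB B f
    by (simp add: loewner_le_def psd_iff_kpsd V psd_rank_le_def)
qed

lemma hadamard_superadditive_pow:
  fixes V :: "(real ^ 'n ^ 'n) set"
  assumes h: "pow_pair h h'" and f: "\<And>y. y \<in> I \<Longrightarrow> f y = h \<alpha> y" and V: "V = psd_rank_le k I"
    and \<alpha>: "2 \<le> \<alpha>" "real CARD('n) \<le> \<alpha>"
  shows "hadamard_superadditive I V f"
  using kpsd_pow_superadd[OF finite h \<alpha>] f
  by (auto simp: hadamard_superadditive_def loewner_le_def V psd_rank_le_def entries_in_def
      psd_iff_kpsd)

section \<open>Rank one\<close>

text \<open>All columns are multiples of one vector, so 2 by 2 minors vanish and a row through a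
  nonzero diagonal entry determines the matrix. The Schur complement factors that row with the right
  normalisation.\<close>

lemma psd_rank_one_obtain:
  fixes A :: "real ^ 'n ^ 'n"
  assumes A: "psd A" "rank A \<le> 1"
  obtains z where "\<And>i j. A $ i $ j = z i * z j"
proof -
  obtain B where B: "columns A \<subseteq> span B" "independent B" "card B = dim (columns A)"
    using basis_exists[of "columns A"] by metis
  then have "finite B" "card B \<le> 1"
    using A(2) independent_imp_finite by (auto simp: column_rank_def)
  then obtain w where "B \<subseteq> {w}"
    by (metis card_1_singletonE card_0_eq empty_subsetI le_eq_less_or_eq less_one subset_refl)
  then have "columns A \<subseteq> span {w}"
    using B(1) span_mono by blast
  then have "\<exists>r. column j A = r *\<^sub>R w" for j
    by (auto simp: columns_def span_singleton subset_iff)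
  then obtain r where r: "\<And>j. column j A = r j *\<^sub>R w"
    by metis
  have entry: "A $ i $ j = r j * w $ i" for i j
    using arg_cong[OF r[of j], of "\<lambda>v. v $ i"] by (simp add: column_def)
  have row: "\<exists>z. \<forall>i. A $ a $ i = z a * z i" for a
    using kpsd_schur_complement[of "UNIV - {a}" a "\<lambda>i j. A $ i $ j"] A(1)
    by (auto simp: psd_iff_kpsd insert_absorb)
  show thesis
  proof (cases "\<exists>a. A $ a $ a \<noteq> 0")
    case True
    then obtain a where a: "A $ a $ a \<noteq> 0" by blast
    obtain z where z: "\<And>i. A $ a $ i = z a * z i"
      using row by blast
    have za: "z a \<noteq> 0"
      using a z by auto
    have "A $ i $ j = z i * z j" for i j
    proof -
      have "A $ i $ a = z a * z i"
        using kpsd_sym[of UNIV "\<lambda>i j. A $ i $ j" i a] A(1) z by (simp add: psd_iff_kpsd)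
      moreover have "A $ a $ a * A $ i $ j = A $ i $ a * A $ a $ j"
        by (simp add: entry)
      ultimately show ?thesis
        using za by (simp add: z)
    qed
    then show ?thesis by (rule that)
  next
    case False
    \<comment> \<open>A zero diagonal entry gives \<open>z a = 0\<close> in the factorisation of row
      \<open>a\<close>, so the row vanishes.\<close>
    have "A $ a $ i = 0" for a i
      using False row[of a] by (metis mult_zero_left mult_eq_0_iff)
    then show ?thesis
      using that[of "\<lambda>_. 0"] by simp
  qed
qed

text \<open>A vector orthogonal to \<open>z\<close> must be orthogonal to \<open>w\<close>, so
  \<open>w\<close> is a multiple of \<open>z\<close>; a diagonal entry bounds the squared ratio
  \<open>s\<close> by 1.\<close>

lemma rank_one_loewner:
  fixes z w :: "'n::finite \<Rightarrow> real"
  assumes "kpsd UNIV (\<lambda>i j. z i * z j - w i * w j)"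
  obtains s where "0 \<le> s" "s \<le> 1" "\<And>i j. w i * w j = s * (z i * z j)"
proof -
  have form: "(\<Sum>i\<in>UNIV. c i * w i)\<^sup>2 \<le> (\<Sum>i\<in>UNIV. c i * z i)\<^sup>2" for c
    using kpsd_nonneg[OF assms, of c]
    by (simp add: right_diff_distrib sum_subtractf power2_eq_square sum_product mult_ac)
  have diag: "w a * w a \<le> z a * z a" for a
    using kpsd_diag[OF _ assms, of a] by simp
  show thesis
  proof (cases "\<exists>a. z a \<noteq> 0")
    case True
    then obtain a where a: "z a \<noteq> 0" by blast
    have "w i = w a / z a * z i" for i
    proof -
      \<comment> \<open>This vector, \<open>z a\<close> at \<open>i\<close> and \<open>- z i\<close>
        at \<open>a\<close>, is orthogonal to \<open>z\<close>.\<close>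
      let ?c = "\<lambda>j. (if j = i then z a else 0) - (if j = a then z i else 0)"
      have c: "(\<Sum>j\<in>UNIV. ?c j * y j) = z a * y i - z i * y a" for y :: "'n \<Rightarrow> real"
        by (simp add: left_diff_distrib sum_subtractf if_distrib[of "\<lambda>t. t * _"] cong: if_cong)
      have "(z a * w i - z i * w a)\<^sup>2 \<le> 0"
        using form[of ?c] unfolding c by simp
      then show ?thesis
        using a by (simp add: field_simps)
    qed
    then have "w i * w j = (w a / z a)\<^sup>2 * (z i * z j)" for i j
      by (metis (no_types) mult.assoc mult.commute power2_eq_square)
    moreover have "(w a / z a)\<^sup>2 \<le> 1"
      using diag[of a] a by (simp add: power_divide power2_eq_square divide_le_eq)
    ultimately show ?thesis
      using that[of "(w a / z a)\<^sup>2"] by simp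
  next
    case False
    then have "w a * w a \<le> 0" for a
      using diag[of a] by simp
    then have "w a = 0" for a
      by (metis mult_eq_0_iff order_antisym zero_le_square)
    then show ?thesis
      using that[of 0] by simp
  qed
qed

lemma pow_pair_rank_one_kpsd:
  assumes h: "pow_pair h h'" and A: "\<And>i j. A $ i $ j = z i * z j"
  shows "kpsd UNIV (\<lambda>i j. h \<alpha> (A $ i $ j))"
  by (simp add: A pow_pair_mult[OF h] kpsd_rank_one)

lemma rank_one_pair:
  fixes A B :: "real ^ 'n ^ 'n"
  assumes A: "A \<in> psd_rank_le 1 I" and B: "B \<in> psd_rank_le 1 I" and AB: "B \<preceq>\<^sub>L A"
  obtains z s where "\<And>i j. A $ i $ j = z i * z j" "0 \<le> s" "s \<le> 1"
    "\<And>i j. B $ i $ j = s * A $ i $ j"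
proof -
  obtain z where z: "\<And>i j. A $ i $ j = z i * z j"
    using psd_rank_one_obtain A by (auto simp: psd_rank_le_def)
  obtain w where w: "\<And>i j. B $ i $ j = w i * w j"
    using psd_rank_one_obtain B by (auto simp: psd_rank_le_def)
  have "kpsd UNIV (\<lambda>i j. z i * z j - w i * w j)"
    using AB by (simp add: loewner_le_def psd_iff_kpsd z w)
  then obtain s where "0 \<le> s" "s \<le> 1" "\<And>i j. w i * w j = s * (z i * z j)"
    using rank_one_loewner by blast
  then show thesis
    using that[of z s] z w by simp
qed

text \<open>Multiplicativity turns \<open>z z\<^sup>T\<close> into another rank one matrix, for
  every real \<alpha>.\<close>

lemma hadamard_positive_rank_one:
  assumes h: "pow_pair h h'" and f: "\<And>y. y \<in> I \<Longrightarrow> f y = h \<alpha> y" and V: "V = psd_rank_le 1 I"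
  shows "hadamard_positive V f"
  unfolding hadamard_positive_def
proof
  fix A assume A: "A \<in> V"
  obtain z where "\<And>i j. A $ i $ j = z i * z j"
    using psd_rank_one_obtain A by (auto simp: V psd_rank_le_def)
  from pow_pair_rank_one_kpsd[OF h this, of \<alpha>] show "0 \<preceq>\<^sub>L map_matrix f A"
    using A f by (simp add: V loewner_le_def psd_rank_le_def entries_in_def psd_iff_kpsd)
qed

text \<open>With \<open>B = s A\<close> the difference is \<open>h \<alpha>\<close> of
  \<open>A\<close> scaled by \<open>1 - s powr \<alpha>\<close>, which is nonnegative.\<close>

lemma hadamard_monotone_rank_one:
  assumes h: "pow_pair h h'" and f: "\<And>y. y \<in> I \<Longrightarrow> f y = h \<alpha> y" and V: "V = psd_rank_le 1 I"
    and \<alpha>: "0 \<le> \<alpha>"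
  shows "hadamard_monotone V f"
  unfolding hadamard_monotone_def
proof (intro ballI impI; elim conjE)
  fix A B assume A: "A \<in> V" and B: "B \<in> V" and AB: "B \<preceq>\<^sub>L A"
  obtain z s where z: "\<And>i j. A $ i $ j = z i * z j" and s: "0 \<le> s" "s \<le> 1"
    and BA: "\<And>i j. B $ i $ j = s * A $ i $ j"
    using rank_one_pair A B AB V by metis
  have ent: "A $ i $ j \<in> I" "s * A $ i $ j \<in> I" for i j
    using A B by (auto simp: V psd_rank_le_def entries_in_def simp flip: BA)
  have "s powr \<alpha> \<le> 1"
    using s \<alpha> by (simp add: powr_le1)
  then have "kpsd UNIV (\<lambda>i j. (1 - s powr \<alpha>) * h \<alpha> (A $ i $ j))"
    by (intro kpsd_scale pow_pair_rank_one_kpsd[OF h z]) simp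
  then show "map_matrix f B \<preceq>\<^sub>L map_matrix f A"
    using s by (simp add: loewner_le_def psd_iff_kpsd BA f ent pow_pair_mult[OF h]
        pow_pair_nonneg[OF h] left_diff_distrib)
qed

lemma powr_convex_unit:
  fixes \<alpha> s t :: real
  assumes \<alpha>: "1 \<le> \<alpha>" and s: "0 \<le> s" "s \<le> 1" and t: "0 \<le> t" "t \<le> 1"
  shows "(t + (1 - t) * s) powr \<alpha> \<le> t + (1 - t) * s powr \<alpha>"
proof (cases "s = 0")
  case True
  have "t powr \<alpha> \<le> t"
    using powr_mono'[of 1 \<alpha> t] \<alpha> t by simp
  then show ?thesis
    using True by simp
next
  case False
  then show ?thesis
    using convex_onD[OF powr_convex[OF \<alpha>], of "1 - t" 1 s] s t by simp
qed

text \<open>With \<open>B = s A\<close> the gap is \<open>h \<alpha>\<close> of \<open>A\<close>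
  scaled by the gap in the scalar convexity inequality between 1 and \<open>s\<close>.\<close>

lemma hadamard_convex_rank_one:
  assumes h: "pow_pair h h'" and f: "\<And>y. y \<in> I \<Longrightarrow> f y = h \<alpha> y" and V: "V = psd_rank_le 1 I"
    and I: "convex I" and \<alpha>: "1 \<le> \<alpha>"
  shows "hadamard_convex V f"
  unfolding hadamard_convex_def
proof (intro allI ballI impI; elim conjE)
  fix t :: real and A B
  assume A: "A \<in> V" and B: "B \<in> V" and t: "0 \<le> t" "t \<le> 1" and AB: "B \<preceq>\<^sub>L A"
  obtain z s where z: "\<And>i j. A $ i $ j = z i * z j" and s: "0 \<le> s" "s \<le> 1"
    and BA: "\<And>i j. B $ i $ j = s * A $ i $ j"
    using rank_one_pair A B AB V by metis
  have ent: "A $ i $ j \<in> I" "s * A $ i $ j \<in> I" for i j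
    using A B by (auto simp: V psd_rank_le_def entries_in_def simp flip: BA)
  define r where "r = t + (1 - t) * s"
  have r: "0 \<le> r"
    using s t by (simp add: r_def)
  have comb: "t * A $ i $ j + (1 - t) * (s * A $ i $ j) = r * A $ i $ j" for i j
    by (simp add: r_def algebra_simps)
  have ent': "r * A $ i $ j \<in> I" for i j
    using convexD[OF I ent[of i j], of t "1 - t"] t by (simp add: comb)
  have eq: "(t + (1 - t) * s powr \<alpha> - r powr \<alpha>) * h \<alpha> (A $ i $ j)
      = t * f (A $ i $ j) + (1 - t) * f (s * A $ i $ j) - f (t * A $ i $ j + (1 - t) * (s * A $ i $ j))" for i j
    unfolding comb using s r
    by (simp add: f ent ent' pow_pair_mult[OF h] pow_pair_nonneg[OF h] left_diff_distrib distrib_right)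
  have "kpsd UNIV (\<lambda>i j. (t + (1 - t) * s powr \<alpha> - r powr \<alpha>) * h \<alpha> (A $ i $ j))"
    using powr_convex_unit[OF \<alpha> s t]
    by (intro kpsd_scale pow_pair_rank_one_kpsd[OF h z]) (simp add: r_def)
  then show "map_matrix f (t *\<^sub>R A + (1 - t) *\<^sub>R B)
      \<preceq>\<^sub>L t *\<^sub>R map_matrix f A + (1 - t) *\<^sub>R map_matrix f B"
    unfolding eq by (simp add: loewner_le_def psd_iff_kpsd BA)
qed

text \<open>The midpoint of the all-ones matrix and 0 would give
  \<open>(1/2) powr \<alpha> \<le> 1/2\<close>, since the power vanishes at 0 even for \<alpha>
  \<le> 0.\<close>

lemma not_hadamard_convex_less_one:
  fixes V :: "(real ^ 'n ^ 'n) set"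
  assumes f: "\<And>y. 0 \<le> y \<Longrightarrow> f y = y powr \<alpha>" and I: "{0..} \<subseteq> I"
    and V: "V = psd_rank_le k I" "1 \<le> k" and \<alpha>: "\<alpha> < 1"
  shows "\<not> hadamard_convex V f"
proof
  assume conv: "hadamard_convex V f"
  let ?A = "(\<chi> i j. 1) :: real ^ 'n ^ 'n"
  have mem: "?A \<in> V" "0 \<in> V"
    using rank_one_mem[OF V(2) I, of "\<lambda>_::'n. 1"] rank_one_mem[OF V(2) I, of "\<lambda>_::'n. 0"]
    by (simp_all add: V(1) zero_vec_def)
  then have "psd ?A" "psd (0 :: real ^ 'n ^ 'n)"
    by (auto simp: V(1) psd_rank_le_def)
  then have "psd ((1/2) *\<^sub>R map_matrix f ?A + (1 - 1/2) *\<^sub>R map_matrix f 0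
      - map_matrix f ((1/2) *\<^sub>R ?A + (1 - 1/2) *\<^sub>R 0))"
    using conv[unfolded hadamard_convex_def, rule_format, of ?A 0 "1/2"] mem
    by (simp add: loewner_le_def)
  from kpsd_diag[OF _ this[unfolded psd_iff_kpsd], of undefined]
  have "(1/2) powr \<alpha> \<le> 1/2"
    by (simp add: f)
  moreover have "(1/2::real) powr 1 < (1/2) powr \<alpha>"
    using \<alpha> by (intro powr_less_mono') auto
  ultimately show False by simp
qed

section \<open>Assembling the critical exponents\<close>

text \<open>Minimality only takes failure at exponents arbitrarily close below \<open>a\<close>, so
  the counterexamples may be confined to a left neighbourhood of \<open>a\<close>.\<close>

lemma critical_exponentI:
  assumes "0 \<le> a" "\<And>\<alpha>. a \<le> \<alpha> \<Longrightarrow> P \<alpha>" "a = 0 \<or> (\<forall>\<^sub>F \<alpha> in at_left a. \<not> P \<alpha>)"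
  shows "critical_exponent P a"
  unfolding critical_exponent_def
proof (intro conjI allI impI; (elim conjE)?)
  fix b assume b: "0 \<le> b" "\<forall>\<alpha>\<ge>b. P \<alpha>"
  show "a \<le> b"
  proof (rule ccontr)
    assume "\<not> a \<le> b"
    then obtain d where d: "d < a" "\<And>y. d < y \<Longrightarrow> y < a \<Longrightarrow> \<not> P y"
      using assms(3) b(1) unfolding eventually_at_left_field by auto
    \<comment> \<open>This point lies above both \<open>b\<close> and \<open>d\<close> and below
      \<open>a\<close>.\<close>
    have "\<not> P ((max b d + a) / 2)"
      using \<open>\<not> a \<le> b\<close> d(1) by (intro d(2)) auto
    moreover have "b \<le> (max b d + a) / 2"
      using \<open>\<not> a \<le> b\<close> by auto
    ultimately show False
      using b(2) by blast
  qed
qed (use assms in auto)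

lemma eventually_at_left_unit:
  fixes a :: real
  assumes "\<And>\<alpha>. a - 1 < \<alpha> \<Longrightarrow> \<alpha> < a \<Longrightarrow> Q \<alpha>"
  shows "\<forall>\<^sub>F \<alpha> in at_left a. Q \<alpha>"
  unfolding eventually_at_left_field using assms by (intro exI[of _ "a - 1"]) auto

theorem corollary1p4:
  fixes k :: nat
    and g :: "real \<Rightarrow> real \<Rightarrow> real"
    and I :: "real set"
    and V :: "(real ^ 'n ^ 'n) set"
  assumes "CARD('n) \<ge> 2" and "1 \<le> k" and "k \<le> CARD('n)"
    and "(g, I) \<in> {(f_pow, {0..}), (phi_pow, UNIV), (psi_pow, UNIV)}"
    and "V = psd_rank_le k I"
  shows "(2 \<le> k \<longrightarrow>
            critical_exponent (\<lambda>\<alpha>. hadamard_positive V (g \<alpha>)) (real CARD('n) - 2) \<and>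
            critical_exponent (\<lambda>\<alpha>. hadamard_monotone V (g \<alpha>)) (real CARD('n) - 1) \<and>
            critical_exponent (\<lambda>\<alpha>. hadamard_convex V (g \<alpha>)) (real CARD('n)) \<and>
            critical_exponent (\<lambda>\<alpha>. hadamard_superadditive I V (g \<alpha>)) (real CARD('n))) \<and>
         (k = 1 \<longrightarrow>
            critical_exponent (\<lambda>\<alpha>. hadamard_positive V (g \<alpha>)) 0 \<and>
            critical_exponent (\<lambda>\<alpha>. hadamard_monotone V (g \<alpha>)) 0 \<and>
            critical_exponent (\<lambda>\<alpha>. hadamard_convex V (g \<alpha>)) 1 \<and>
            critical_exponent (\<lambda>\<alpha>. hadamard_superadditive I V (g \<alpha>)) (real CARD('n)))"
proof -
  note n = assms(1) and k = assms(2) and V = assms(5)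
  obtain h h' where h: "pow_pair h h'" and gh: "\<And>\<alpha> y. y \<in> I \<Longrightarrow> g \<alpha> y = h \<alpha> y"
  proof -
    have "pow_pair phi_pow psi_pow" "pow_pair psi_pow phi_pow"
      by (auto simp: pow_pair_def)
    moreover have "f_pow \<alpha> y = phi_pow \<alpha> y" if "0 \<le> y" for \<alpha> y
      using that by (simp add: f_pow_def phi_pow_def)
    ultimately show thesis
      using assms(4) that by auto
  qed
  have I: "{0..} \<subseteq> I" and conv: "convex I"
    using assms(4) by auto
  have pow: "g \<alpha> y = y powr \<alpha>" if "0 \<le> y" for \<alpha> y
    using gh[of y \<alpha>] pow_pair_nonneg[OF h that] that I by auto
  \<comment> \<open>The counterexample has rank one, so this exponent is the same for all
    \<open>k\<close>.\<close>
  have super: "critical_exponent (\<lambda>\<alpha>. hadamard_superadditive I V (g \<alpha>)) (real CARD('n))"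
    using n eventually_not_hadamard_superadditive[OF pow I V k]
    by (intro critical_exponentI hadamard_superadditive_pow[OF h gh V]) auto
  have "critical_exponent (\<lambda>\<alpha>. hadamard_positive V (g \<alpha>)) (real CARD('n) - 2)" if k2: "2 \<le> k"
  proof (rule critical_exponentI)
    show "real CARD('n) - 2 = 0 \<or> (\<forall>\<^sub>F \<alpha> in at_left (real CARD('n) - 2). \<not> hadamard_positive V (g \<alpha>))"
    \<comment> \<open>For n = 2 the exponent is 0, and minimality among nonnegative reals is
      automatic.\<close>
    proof (cases "CARD('n) = 2")
      case False
      then obtain m where "CARD('n) = m + 3"
        using n by (metis add.commute le_Suc_ex le_antisym not_less_eq_eq numeral_3_eq_3 numeral_2_eq_2)
      then show ?thesis
        by (intro disjI2 eventually_at_left_unit not_hadamard_positive[OF pow I V k2]) auto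
    qed simp
  qed (use n in \<open>auto intro: hadamard_positive_pow[OF h gh V]\<close>)
  moreover have "critical_exponent (\<lambda>\<alpha>. hadamard_monotone V (g \<alpha>)) (real CARD('n) - 1)" if k2: "2 \<le> k"
  proof (rule critical_exponentI)
    obtain m where "CARD('n) = m + 2"
      using n by (metis add.commute le_Suc_ex)
    then show "real CARD('n) - 1 = 0 \<or> (\<forall>\<^sub>F \<alpha> in at_left (real CARD('n) - 1). \<not> hadamard_monotone V (g \<alpha>))"
      by (intro disjI2 eventually_at_left_unit not_hadamard_monotone[OF pow I V k2]) auto
  qed (use n in \<open>auto intro: hadamard_monotone_pow[OF h gh V]\<close>)
  moreover have "critical_exponent (\<lambda>\<alpha>. hadamard_convex V (g \<alpha>)) (real CARD('n))" if k2: "2 \<le> k"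
  proof (rule critical_exponentI)
    obtain m where "CARD('n) = m + 1"
      using n by (metis add.commute le_Suc_ex one_le_numeral order_trans)
    then show "real CARD('n) = 0 \<or> (\<forall>\<^sub>F \<alpha> in at_left (real CARD('n)). \<not> hadamard_convex V (g \<alpha>))"
      by (intro disjI2 eventually_at_left_unit not_hadamard_convex[OF pow I V k2]) auto
  qed (use n in \<open>auto intro: hadamard_convex_pow[OF h gh V conv]\<close>)
  moreover have "critical_exponent (\<lambda>\<alpha>. hadamard_positive V (g \<alpha>)) 0
      \<and> critical_exponent (\<lambda>\<alpha>. hadamard_monotone V (g \<alpha>)) 0
      \<and> critical_exponent (\<lambda>\<alpha>. hadamard_convex V (g \<alpha>)) 1" if "k = 1"
  proof (intro conjI critical_exponentI)
    note V1 = V[unfolded that]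
    show "hadamard_positive V (g \<alpha>)" for \<alpha>
      by (rule hadamard_positive_rank_one[OF h gh V1])
    show "hadamard_monotone V (g \<alpha>)" if "0 \<le> \<alpha>" for \<alpha>
      by (rule hadamard_monotone_rank_one[OF h gh V1 that])
    show "hadamard_convex V (g \<alpha>)" if "1 \<le> \<alpha>" for \<alpha>
      by (rule hadamard_convex_rank_one[OF h gh V1 conv that])
    show "1 = (0::real) \<or> (\<forall>\<^sub>F \<alpha> in at_left 1. \<not> hadamard_convex V (g \<alpha>))"
      by (intro disjI2 eventually_at_left_unit not_hadamard_convex_less_one[OF pow I V k])
  qed auto
  ultimately show ?thesis
    using super by blast
qed

end
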